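(* Let $n\ge1$, $0<\lambda<n$, $1\le p,q\le\infty$ and $s,t\in\mathbb{R}$. Then $\mathcal{I}_\lambda$ is bounded from $l(p,t)$ to $l(q,s)$ if and only if $(q,p,s,t)$ satisfies at least one of the conditions $\mathcal{C}_1,\mathcal{C}_3,\mathcal{C}_4$ below. $(\mathcal{C}_1)$: $s\le t$; $\frac\lambda n+\big(\frac1q+\frac sn\big)\vee0<\big(\frac1p+\frac tn\big)\vee0$; $\frac\lambda n+\frac1q+\frac sn\le1$; and $(q',-s)=(1,\lambda-n)$ if $\frac\lambda n+\frac1q+\frac sn=1$. $(\mathcal{C}_3)$: $s\le t$; $p=1$, $t=\lambda-n$, $\frac1q+\frac sn<0$. $(\mathcal{C}_4)$: $s\le t$; $\frac\lambda n+\frac1q+\frac sn=\frac1p+\frac tn$, $\frac1q\le\frac1p$; $\frac1q+\frac sn>0$, $\frac1p+\frac tn<1$; and if $s=t$ then $q\ne\infty$ and $p\ne1$.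
   Context: For $k\in\mathbb{Z}^n$, $\langle k\rangle=(1+|k|^2)^{1/2}$. For $1\le p\le\infty$, $s\in\mathbb{R}$, $l(p,s)$ is the space of $a:\mathbb{Z}^n\to\mathbb{C}$ with $\|a\|_{l(p,s)}=\big(\sum_{k}|a(k)|^p\langle k\rangle^{ps}\big)^{1/p}<\infty$ (supremum of $|a(k)|\langle k\rangle^s$ when $p=\infty$). The discrete fractional integral operator is $(\mathcal{I}_\lambda f)(k)=\sum_{j\in\mathbb{Z}^n,\,j\ne k}\frac{f(j)}{|k-j|^{n-\lambda}}$. "Bounded from $l(p,t)$ to $l(q,s)$" means $\|\mathcal{I}_\lambda f\|_{l(q,s)}\le C\|f\|_{l(p,t)}$ for all $f\in l(p,t)$. Conventions: $1/\infty=0$; $q'$ is the dual exponent, $1/q+1/q'=1$; $a\vee b=\max\{a,b\}$. *)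

theory Defs
  imports "HOL-Analysis.Analysis"
begin

text \<open>Lattice points of Z^n are modelled as int ^ 'n, with n = CARD('n).
  Exponents p in [1,infinity] are extended reals.\<close>

definition lat_norm :: "int ^ 'n \<Rightarrow> real" where
  "lat_norm k = sqrt (\<Sum>i\<in>UNIV. (real_of_int (k $ i))\<^sup>2)"

definition jbr :: "int ^ 'n \<Rightarrow> real" where
  "jbr k = sqrt (1 + (lat_norm k)\<^sup>2)"

definition recip :: "ereal \<Rightarrow> real" where
  "recip p = (if p = \<infinity> then 0 else 1 / real_of_ereal p)"

definition dual_exp :: "ereal \<Rightarrow> ereal" where
  "dual_exp q = (if q = 1 then \<infinity> else if q = \<infinity> then 1
                 else ereal (real_of_ereal q / (real_of_ereal q - 1)))"

definition in_lps :: "ereal \<Rightarrow> real \<Rightarrow> (int ^ 'n \<Rightarrow> complex) \<Rightarrow> bool" where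
  "in_lps p s a = (if p = \<infinity> then bdd_above (range (\<lambda>k. norm (a k) * jbr k powr s))
     else (\<lambda>k. norm (a k) powr real_of_ereal p * jbr k powr (real_of_ereal p * s)) summable_on UNIV)"

definition lps_norm :: "ereal \<Rightarrow> real \<Rightarrow> (int ^ 'n \<Rightarrow> complex) \<Rightarrow> real" where
  "lps_norm p s a = (if p = \<infinity> then (SUP k. norm (a k) * jbr k powr s)
     else (\<Sum>\<^sub>\<infinity>k. norm (a k) powr real_of_ereal p * jbr k powr (real_of_ereal p * s))
            powr (1 / real_of_ereal p))"

text \<open>Discrete fractional integral operator (the series is required to converge
  where it is used).\<close>
definition frac_int :: "real \<Rightarrow> (int ^ ('n::finite) \<Rightarrow> complex) \<Rightarrow> int ^ 'n \<Rightarrow> complex" where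
  "frac_int lam f k = (\<Sum>\<^sub>\<infinity>j\<in>UNIV - {k}. f j / complex_of_real (lat_norm (k - j) powr (real CARD('n) - lam)))"

definition frac_int_bounded :: "real \<Rightarrow> ('n::finite) itself \<Rightarrow> ereal \<Rightarrow> real \<Rightarrow> ereal \<Rightarrow> real \<Rightarrow> bool" where
  "frac_int_bounded lam _ p t q s =
    (\<exists>C. \<forall>f :: int ^ 'n \<Rightarrow> complex. in_lps p t f \<longrightarrow>
        (\<forall>k. (\<lambda>j. f j / complex_of_real (lat_norm (k - j) powr (real CARD('n) - lam))) summable_on (UNIV - {k}))
        \<and> in_lps q s (frac_int lam f)
        \<and> lps_norm q s (frac_int lam f) \<le> C * lps_norm p t f)"

end

theory Submission
  imports Defs
begin

text \<open>
  Write \<open>x = 1/p\<close>, \<open>y = 1/q\<close>, \<open>n\<close> for the dimension. The operator is bounded iff the kernel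
  \<open>\<langle>k\<rangle>^s |k - j|^(\<lambda> - n) \<langle>j\<rangle>^(-t)\<close> maps \<open>l^p\<close> to \<open>l^q\<close> with a bound that is uniform
  over finite index sets.

  Sufficiency. Where \<open>\<langle>k\<rangle>\<close> and \<open>\<langle>j\<rangle>\<close> differ by a factor 2 or more, the kernel is a product of powers of
  \<open>\<langle>k\<rangle>\<close> and \<open>\<langle>j\<rangle>\<close>, and a Schur test with power weights applies. Where they are comparable, the
  weights collapse to \<open>\<langle>k\<rangle>^(s - t)\<close>; off the critical line, or when \<open>s < t\<close>, the Schur test
  still works, and for \<open>s = t\<close> on the critical line the bound is the Hardy--Littlewood--Sobolev
  inequality. For the latter, enumerate \<open>f\<close> and \<open>g = K f\<close> in decreasing order: the bound
  \<open>\<Sum>k\<in>G. |k - j|^(\<lambda> - n) \<le> C |G|^(\<lambda>/n)\<close> and summation by parts give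
  \<open>g(b) \<le> C \<Sum>a. f(a) max(a,b)^(\<lambda>/n - 1)\<close>, again a kernel of power type, now on the naturals. The
  case \<open>q < p\<close> is reduced to \<open>q = p\<close> by Hoelder's inequality.

  Necessity. Testing on functions that are constant on the dyadic cubes \<open>[2^m, 2^(m+1))^n\<close> turns
  boundedness into that of the matrix
  \<open>2^(l (n y + s) + m (n - n x - t) + max(l,m) (\<lambda> - n))\<close>, \<open>l \<noteq> m\<close>, whose entries, rows and columns
  give all conditions except \<open>s \<le> t\<close>, which comes from neighbouring points, and the
  end points for \<open>s = t\<close>, where translation to infinity removes the weights.
\<close>

section \<open>Finite norms and Hoelder's inequality\<close>

lemma weighted_amgm:
  fixes a b x :: real
  assumes "0 \<le> a" "0 \<le> b" "0 < x" "x < 1"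
  shows "a powr x * b powr (1 - x) \<le> x * a + (1 - x) * b"
proof (cases "a = 0 \<or> b = 0")
  case True
  then show ?thesis using assms by auto
next
  case False
  then show ?thesis using assms by (intro Youngs_inequality_0) auto
qed

text \<open>After dividing both families by their sums, summing the weighted AM-GM inequality gives
  total 1. If one sum vanishes, so does every product, hence the separate case.\<close>

lemma Holder_sum_powr:
  fixes a b :: "'a \<Rightarrow> real"
  assumes "\<And>i. i \<in> F \<Longrightarrow> 0 \<le> a i" "\<And>i. i \<in> F \<Longrightarrow> 0 \<le> b i" "0 < x" "x < 1" "finite F"
  shows "(\<Sum>i\<in>F. a i powr x * b i powr (1 - x)) \<le> (\<Sum>i\<in>F. a i) powr x * (\<Sum>i\<in>F. b i) powr (1 - x)"
proof (cases "sum a F = 0 \<or> sum b F = 0")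
  case True
  then have "\<And>i. i \<in> F \<Longrightarrow> a i powr x * b i powr (1 - x) = 0"
    using assms by (auto simp: sum_nonneg_eq_0_iff)
  then have "(\<Sum>i\<in>F. a i powr x * b i powr (1 - x)) = 0"
    by (rule sum.neutral[OF ballI])
  then show ?thesis by simp
next
  case False
  then have pos: "0 < sum a F" "0 < sum b F"
    using assms(1,2) by (metis less_eq_real_def sum_nonneg)+
  have "(\<Sum>i\<in>F. (a i / sum a F) powr x * (b i / sum b F) powr (1 - x))
      \<le> (\<Sum>i\<in>F. x * (a i / sum a F) + (1 - x) * (b i / sum b F))"
    using assms pos by (intro sum_mono weighted_amgm) auto
  also have "\<dots> = 1"
    using pos by (simp add: sum.distrib flip: sum_distrib_left sum_divide_distrib)
  finally have "(\<Sum>i\<in>F. (a i powr x * b i powr (1 - x)) / (sum a F powr x * sum b F powr (1 - x))) \<le> 1"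
    using assms pos by (simp add: powr_divide)
  then show ?thesis
    using pos by (simp flip: sum_divide_distrib add: pos_divide_le_eq)
qed

text \<open>The parameter x is the reciprocal exponent, so x = 0 encodes the supremum. The predicate is only
  meaningful for nonnegative f and D, since powr takes junk values on negative bases.\<close>

definition lp_le :: "real \<Rightarrow> 'a set \<Rightarrow> ('a \<Rightarrow> real) \<Rightarrow> real \<Rightarrow> bool" where
  "lp_le x F f D \<longleftrightarrow> (if x = 0 then \<forall>i\<in>F. f i \<le> D else (\<Sum>i\<in>F. f i powr (1 / x)) \<le> D powr (1 / x))"

lemma lp_le_mono:
  assumes "lp_le x F g D" "0 \<le> x" "\<And>i. i \<in> F \<Longrightarrow> 0 \<le> f i" "\<And>i. i \<in> F \<Longrightarrow> f i \<le> g i"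
  shows "lp_le x F f D"
proof (cases "x = 0")
  case True
  then show ?thesis using assms unfolding lp_le_def by fastforce
next
  case False
  then have "(\<Sum>i\<in>F. f i powr (1 / x)) \<le> (\<Sum>i\<in>F. g i powr (1 / x))"
    using assms by (intro sum_mono powr_mono2) auto
  then show ?thesis using False assms unfolding lp_le_def by auto
qed

lemma lp_le_weaken:
  assumes "lp_le x F f D" "0 \<le> x" "0 \<le> D" "D \<le> E"
  shows "lp_le x F f E"
proof (cases "x = 0")
  case True
  then show ?thesis using assms unfolding lp_le_def by fastforce
next
  case False
  then have "D powr (1 / x) \<le> E powr (1 / x)"
    using assms by (intro powr_mono2) auto
  then show ?thesis using False assms unfolding lp_le_def by auto
qed

lemma lp_le_subset:
  assumes "lp_le x F f D" "F' \<subseteq> F" "finite F"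
  shows "lp_le x F' f D"
proof (cases "x = 0")
  case False
  then have "(\<Sum>i\<in>F'. f i powr (1 / x)) \<le> (\<Sum>i\<in>F. f i powr (1 / x))"
    using assms by (intro sum_mono2) auto
  then show ?thesis using False assms unfolding lp_le_def by auto
qed (use assms in \<open>auto simp: lp_le_def\<close>)

lemma lp_le_reindex:
  assumes "inj_on h F"
  shows "lp_le x (h ` F) f D \<longleftrightarrow> lp_le x F (\<lambda>i. f (h i)) D"
  using assms unfolding lp_le_def by (auto simp: sum.reindex)

lemma lp_le_scale:
  assumes "lp_le x F f D" "0 \<le> c" "\<And>i. i \<in> F \<Longrightarrow> 0 \<le> f i" "0 \<le> D"
  shows "lp_le x F (\<lambda>i. c * f i) (c * D)"
proof (cases "x = 0")
  case False
  then show ?thesis using assms unfolding lp_le_def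
    by (auto simp: powr_mult mult_left_mono simp flip: sum_distrib_left)
qed (use assms in \<open>auto simp: lp_le_def mult_left_mono\<close>)

text \<open>The constant 4 stands in for Minkowski's inequality: with p = 1/x, (f + g)^p <= 2^p (f^p
  + g^p), and the remaining factor 2 is at most 2^p because p >= 1.\<close>

lemma lp_le_add:
  assumes f: "lp_le x F f A" and g: "lp_le x F g B" and x: "0 \<le> x" "x \<le> 1" and nn: "0 \<le> A" "0 \<le> B"
    and f0: "\<And>i. i \<in> F \<Longrightarrow> 0 \<le> f i" and g0: "\<And>i. i \<in> F \<Longrightarrow> 0 \<le> g i"
  shows "lp_le x F (\<lambda>i. f i + g i) (4 * (A + B))"
proof (cases "x = 0")
  case True
  have "f i + g i \<le> 4 * (A + B)" if "i \<in> F" for i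
    using f g True that nn unfolding lp_le_def by (auto dest!: bspec[OF _ that])
  then show ?thesis using True unfolding lp_le_def by auto
next
  case False
  define p where "p = 1 / x"
  have p: "p \<ge> 1" using x False by (simp add: p_def)
  have "(f i + g i) powr p \<le> 2 powr p * f i powr p + 2 powr p * g i powr p" if "i \<in> F" for i
  proof -
    have "(f i + g i) powr p \<le> (2 * max (f i) (g i)) powr p"
      using f0[OF that] g0[OF that] p by (intro powr_mono2) auto
    also have "\<dots> = 2 powr p * max (f i) (g i) powr p"
      using f0[OF that] g0[OF that] by (simp add: powr_mult)
    also have "\<dots> \<le> 2 powr p * (f i powr p + g i powr p)"
      by (intro mult_left_mono) (auto simp: max_def)
    finally show ?thesis by (simp add: algebra_simps)
  qed
  then have "(\<Sum>i\<in>F. (f i + g i) powr p) \<le> (\<Sum>i\<in>F. 2 powr p * f i powr p + 2 powr p * g i powr p)"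
    by (rule sum_mono)
  also have "\<dots> = 2 powr p * (\<Sum>i\<in>F. f i powr p) + 2 powr p * (\<Sum>i\<in>F. g i powr p)"
    by (simp add: sum.distrib sum_distrib_left)
  also have "\<dots> \<le> 2 powr p * A powr p + 2 powr p * B powr p"
    using f g False unfolding lp_le_def p_def by (intro add_mono mult_left_mono) auto
  also have "\<dots> \<le> 2 powr p * (A + B) powr p + 2 powr p * (A + B) powr p"
    using nn p by (intro add_mono mult_left_mono powr_mono2) auto
  also have "\<dots> = 2 powr 1 * (2 powr p * (A + B) powr p)" by simp
  also have "\<dots> \<le> 2 powr p * (2 powr p * (A + B) powr p)"
    using p by (intro mult_right_mono powr_mono) auto
  also have "\<dots> = (4 * (A + B)) powr p"
  proof -
    have "2 powr p * 2 powr p = (4::real) powr p"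
      by (simp flip: powr_mult)
    then show ?thesis using nn by (simp only: powr_mult[of 4 "A + B"] flip: mult.assoc)
  qed
  finally show ?thesis using False unfolding lp_le_def p_def by auto
qed

lemma lp_le_point:
  assumes "lp_le x F f D" "0 \<le> x" "i \<in> F" "finite F" "0 \<le> D" "0 \<le> f i"
  shows "f i \<le> D"
proof (cases "x = 0")
  case False
  have "f i powr (1 / x) \<le> (\<Sum>i\<in>F. f i powr (1 / x))"
    using assms by (intro member_le_sum) auto
  also have "\<dots> \<le> D powr (1 / x)" using assms False unfolding lp_le_def by auto
  finally have "f i powr (1 / x) \<le> D powr (1 / x)" .
  then have "(f i powr (1 / x)) powr x \<le> (D powr (1 / x)) powr x"
    by (rule powr_mono2[OF assms(2) powr_ge_zero])
  moreover have "1 / x * x = 1" using False by simp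
  ultimately show ?thesis using assms by (simp only: powr_powr powr_one)
qed (use assms in \<open>auto simp: lp_le_def\<close>)

lemma lp_le_1_iff:
  assumes "\<And>i. i \<in> F \<Longrightarrow> 0 \<le> f i" "0 \<le> D"
  shows "lp_le 1 F f D \<longleftrightarrow> sum f F \<le> D"
  using assms unfolding lp_le_def by simp

lemma lp_le_powr:
  assumes "lp_le x F f D" "0 < x" "finite F" "0 \<le> D"
  shows "(\<Sum>i\<in>F. f i powr (1 / x)) powr x \<le> D"
proof -
  have "(\<Sum>i\<in>F. f i powr (1 / x)) powr x \<le> (D powr (1/x)) powr x"
    using assms unfolding lp_le_def by (intro powr_mono2) (auto intro: sum_nonneg)
  then show ?thesis using assms by (simp add: powr_powr)
qed

lemma lp_le_filter:
  assumes "finite F" "0 \<le> D"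
  shows "lp_le x F (\<lambda>i. if P i then f i else 0) D \<longleftrightarrow> lp_le x {i\<in>F. P i} f D"
proof (cases "x = 0")
  case False
  have "(\<Sum>i\<in>F. (if P i then f i else 0) powr (1 / x)) = (\<Sum>i\<in>F. if P i then f i powr (1 / x) else 0)"
    by (intro sum.cong) auto
  then show ?thesis using assms False unfolding lp_le_def by (simp add: sum.If_cases Int_def)
qed (use assms in \<open>auto simp: lp_le_def\<close>)

lemma lp_le_zero:
  assumes "lp_le x F f 0" "0 \<le> x" "i \<in> F" "finite F" "0 \<le> f i"
  shows "f i = 0"
  using lp_le_point[of x F f 0 i] assms by auto

lemma lp_le_const:
  assumes "0 \<le> x" "finite F" "card F = M" "0 < M"
  shows "lp_le x F (\<lambda>_. real M powr (- x)) 1"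
proof (cases "x = 0")
  case False
  then have "(real M powr (- x)) powr (1 / x) = 1 / real M"
    by (simp add: powr_powr powr_neg_one)
  then show ?thesis using assms False unfolding lp_le_def by simp
qed (use assms in \<open>simp add: lp_le_def\<close>)

text \<open>For a fixed finite \<open>G\<close> the norm bound is a closed condition on the values,
  so bounds for partial sums pass to infinite series.\<close>

lemma lp_le_tendsto:
  assumes lim: "\<And>k. k \<in> G \<Longrightarrow> ((\<lambda>F. S F k) \<longlongrightarrow> w k) Fl" and ne: "Fl \<noteq> bot"
    and le: "eventually (\<lambda>F. lp_le y G (S F) D) Fl" and y: "0 \<le> y"
    and S0: "\<And>F k. 0 \<le> S F k"
  shows "lp_le y G w D"
proof (cases "y = 0")
  case True
  have "w k \<le> D" if "k \<in> G" for k
    by (rule tendsto_upperbound[OF lim[OF that] _ ne])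
      (use le that True in \<open>auto simp: lp_le_def elim: eventually_mono\<close>)
  then show ?thesis using True unfolding lp_le_def by simp
next
  case False
  have "((\<lambda>F. \<Sum>k\<in>G. S F k powr (1 / y)) \<longlongrightarrow> (\<Sum>k\<in>G. w k powr (1 / y))) Fl"
    using lim S0 y False by (intro tendsto_sum tendsto_powr') auto
  then have "(\<Sum>k\<in>G. w k powr (1 / y)) \<le> D powr (1 / y)"
    by (rule tendsto_upperbound[OF _ _ ne]) (use le False in \<open>simp add: lp_le_def\<close>)
  then show ?thesis using False unfolding lp_le_def by simp
qed

lemma lp_le_Holder:
  assumes f: "lp_le x F f A" and g: "lp_le (1 - x) F g B" and x: "0 \<le> x" "x \<le> 1" and nn: "0 \<le> A" "0 \<le> B"
    and fin: "finite F" and f0: "\<And>i. i \<in> F \<Longrightarrow> 0 \<le> f i" and g0: "\<And>i. i \<in> F \<Longrightarrow> 0 \<le> g i"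
  shows "(\<Sum>i\<in>F. f i * g i) \<le> A * B"
proof -
  consider "x = 0" | "x = 1" | "0 < x" "x < 1" using x by linarith
  then show ?thesis
  proof cases
    case 1
    have "(\<Sum>i\<in>F. f i * g i) \<le> (\<Sum>i\<in>F. A * g i)"
      using f g0 1 by (intro sum_mono mult_right_mono) (auto simp: lp_le_def)
    also have "\<dots> \<le> A * B"
      using g 1 g0 nn by (auto simp: lp_le_1_iff mult_left_mono simp flip: sum_distrib_left)
    finally show ?thesis .
  next
    case 2
    have "(\<Sum>i\<in>F. f i * g i) \<le> (\<Sum>i\<in>F. f i * B)"
      using g f0 2 by (intro sum_mono mult_left_mono) (auto simp: lp_le_def)
    also have "\<dots> \<le> A * B"
      using f 2 f0 nn by (auto simp: lp_le_1_iff mult_right_mono simp flip: sum_distrib_right)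
    finally show ?thesis .
  next
    case 3
    have "(\<Sum>i\<in>F. f i * g i) = (\<Sum>i\<in>F. (f i powr (1/x)) powr x * (g i powr (1/(1-x))) powr (1-x))"
      using 3 f0 g0 by (intro sum.cong) (auto simp: powr_powr)
    also have "\<dots> \<le> (\<Sum>i\<in>F. f i powr (1/x)) powr x * (\<Sum>i\<in>F. g i powr (1/(1-x))) powr (1-x)"
      using 3 fin by (intro Holder_sum_powr) auto
    also have "\<dots> \<le> A * B"
      using 3 fin f g nn by (intro mult_mono lp_le_powr) auto
    finally show ?thesis .
  qed
qed

text \<open>Converse of Hoelder's inequality. The test functions are the constant 1 for x = 0, point
  masses for x = 1, and the extremal power of \<open>h\<close> in between.\<close>

lemma lp_le_dual:
  assumes x: "0 \<le> x" "x \<le> 1" and C: "0 \<le> C" and fin: "finite F" and h: "\<And>i. i \<in> F \<Longrightarrow> 0 \<le> h i"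
    and *: "\<And>f. (\<And>i. 0 \<le> f i) \<Longrightarrow> lp_le x F f 1 \<Longrightarrow> (\<Sum>i\<in>F. f i * h i) \<le> C"
  shows "lp_le (1 - x) F h C"
proof -
  consider "x = 0" | "x = 1" | "0 < x" "x < 1" using x by linarith
  then show ?thesis
  proof cases
    case 1
    have "(\<Sum>i\<in>F. 1 * h i) \<le> C" using 1 by (intro *) (auto simp: lp_le_def)
    then show ?thesis using 1 h C by (simp add: lp_le_1_iff)
  next
    case 2
    have "h i \<le> C" if "i \<in> F" for i
    proof -
      have "(\<Sum>j\<in>F. (if j = i then 1 else 0) * h j) \<le> C"
        using 2 fin that by (intro *) (auto simp: lp_le_1_iff)
      also have "(\<Sum>j\<in>F. (if j = i then 1 else 0) * h j) = (\<Sum>j\<in>F. if j = i then h j else 0)"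
        by (intro sum.cong) auto
      finally show ?thesis using that fin by simp
    qed
    then show ?thesis using 2 by (simp add: lp_le_def)
  next
    case 3
    define r where "r = 1 / (1 - x)"
    define S where "S = (\<Sum>i\<in>F. h i powr r)"
    have S0: "0 \<le> S" unfolding S_def by (intro sum_nonneg) auto
    show ?thesis
    proof (cases "S = 0")
      case True
      then show ?thesis using 3 unfolding lp_le_def S_def r_def by auto
    next
      case False
      then have S: "0 < S" using S0 by simp
      have r: "r * x = r - 1" "r > 1" using 3 unfolding r_def by (auto simp: field_simps)
      \<comment> \<open>The equality case of Hoelder: (r - 1) / x = r, so the powers
        \<open>f i powr (1 / x)\<close> equal h^r / S and sum to 1.\<close>
      define f where "f = (\<lambda>i. h i powr (r - 1) / S powr x)"
      have "f i powr (1 / x) = h i powr r / S" for i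
        using 3 S r by (simp add: f_def powr_divide powr_powr field_simps flip: r(1))
      then have "lp_le x F f 1"
        using 3 S unfolding lp_le_def by (simp flip: S_def sum_divide_distrib)
      then have "(\<Sum>i\<in>F. f i * h i) \<le> C"
        by (intro *) (auto simp: f_def)
      also have "(\<Sum>i\<in>F. f i * h i) = (\<Sum>i\<in>F. h i powr r / S powr x)"
      proof (intro sum.cong refl)
        fix i assume i: "i \<in> F"
        have "h i powr (r - 1) * h i = h i powr r"
          using h[OF i] r(2) by (cases "h i = 0") (auto simp: powr_diff)
        then show "f i * h i = h i powr r / S powr x" unfolding f_def by simp
      qed
      also have "\<dots> = S powr (1 - x)"
        using S unfolding S_def[symmetric] by (simp add: powr_diff flip: sum_divide_distrib S_def)
      finally have "(S powr (1 - x)) powr r \<le> C powr r"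
        using r by (intro powr_mono2) auto
      then show ?thesis using 3 S unfolding lp_le_def by (simp add: powr_powr r_def[symmetric] S_def[symmetric])
       (simp add: r_def)
    qed
  qed
qed

section \<open>Kernels bounded between Lebesgue sequence spaces\<close>

text \<open>Splitting w = w^(1/r) w^(1 - 1/r) and applying Hoelder leaves a power of the total
  weight, which is at most 1.\<close>

lemma sum_powr_Jensen:
  fixes w b :: "'a \<Rightarrow> real"
  assumes w: "\<And>i. i \<in> F \<Longrightarrow> 0 \<le> w i" "sum w F \<le> 1" and b: "\<And>i. i \<in> F \<Longrightarrow> 0 \<le> b i"
    and r: "1 \<le> r" and fin: "finite F"
  shows "(\<Sum>i\<in>F. w i * b i) powr r \<le> (\<Sum>i\<in>F. w i * b i powr r)"
proof (cases "r = 1")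
  case True
  then show ?thesis using w b by (simp add: sum_nonneg)
next
  case False
  then have r1: "1 < r" using r by simp
  have S0: "0 \<le> (\<Sum>i\<in>F. w i * b i powr r)" using w by (intro sum_nonneg) auto
  have "(\<Sum>i\<in>F. w i * b i) = (\<Sum>i\<in>F. (w i * b i powr r) powr (1 / r) * w i powr (1 - 1 / r))"
  proof (intro sum.cong refl)
    fix i assume i: "i \<in> F"
    have "w i powr (1 / r) * w i powr (1 - 1 / r) = w i"
      using w(1)[OF i] by (simp flip: powr_add)
    then show "w i * b i = (w i * b i powr r) powr (1 / r) * w i powr (1 - 1 / r)"
      using w(1)[OF i] b[OF i] r1 by (simp add: powr_mult powr_powr mult.commute mult.left_commute)
  qed
  also have "\<dots> \<le> (\<Sum>i\<in>F. w i * b i powr r) powr (1 / r) * (\<Sum>i\<in>F. w i) powr (1 - 1 / r)"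
    using w b r1 fin by (intro Holder_sum_powr) auto
  also have "\<dots> \<le> (\<Sum>i\<in>F. w i * b i powr r) powr (1 / r) * 1"
    using w r1 sum_nonneg[of F w] by (intro mult_left_mono powr_le1) auto
  finally have le: "(\<Sum>i\<in>F. w i * b i) \<le> (\<Sum>i\<in>F. w i * b i powr r) powr (1 / r)" by simp
  have "(\<Sum>i\<in>F. w i * b i) powr r \<le> ((\<Sum>i\<in>F. w i * b i powr r) powr (1 / r)) powr r"
    using w b r1 by (intro powr_mono2 le) (auto intro!: sum_nonneg)
  also have "\<dots> = (\<Sum>i\<in>F. w i * b i powr r)" using S0 r1 by (simp add: powr_powr)
  finally show ?thesis .
qed

text \<open>Meant for nonnegative kernels. Finite sets and nonnegative \<open>f\<close> of norm at
  most 1 avoid every convergence question, while one constant serves all \<open>F\<close> and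
  \<open>G\<close>.\<close>

definition lp_bounded :: "real \<Rightarrow> real \<Rightarrow> ('a \<Rightarrow> 'b \<Rightarrow> real) \<Rightarrow> bool" where
  "lp_bounded x y K \<longleftrightarrow> (\<exists>C\<ge>0. \<forall>F G f. finite F \<longrightarrow> finite G \<longrightarrow> (\<forall>j. 0 \<le> f j) \<longrightarrow> lp_le x F f 1 \<longrightarrow>
     lp_le y G (\<lambda>k. \<Sum>j\<in>F. K k j * f j) C)"

lemma lp_boundedI:
  assumes "0 \<le> C" "\<And>F G f. \<lbrakk>finite F; finite G; \<And>j. 0 \<le> f j; lp_le x F f 1\<rbrakk>
    \<Longrightarrow> lp_le y G (\<lambda>k. \<Sum>j\<in>F. K k j * f j) C"
  shows "lp_bounded x y K"
  using assms unfolding lp_bounded_def by blast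

lemma lp_boundedE:
  assumes "lp_bounded x y K"
  obtains C where "0 \<le> C" "\<And>F G f. \<lbrakk>finite F; finite G; \<And>j. 0 \<le> f j; lp_le x F f 1\<rbrakk>
    \<Longrightarrow> lp_le y G (\<lambda>k. \<Sum>j\<in>F. K k j * f j) C"
  using assms unfolding lp_bounded_def by blast

lemma lp_bounded_mono:
  assumes "lp_bounded x y K'" "0 \<le> y" "0 \<le> c" "\<And>k j. 0 \<le> K k j" "\<And>k j. K k j \<le> c * K' k j"
  shows "lp_bounded x y K"
proof (cases "c = 0")
  case True
  then have "K k j = 0" for k j using assms(4,5)[of k j] by simp
  then show ?thesis by (intro lp_boundedI[of 0]) (auto simp: lp_le_def)
next
  case False
  then have c: "0 < c" using assms by simp
  from assms(1) obtain C where C: "0 \<le> C" "\<And>F G f. \<lbrakk>finite F; finite G; \<And>j. 0 \<le> f j; lp_le x F f 1\<rbrakk>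
    \<Longrightarrow> lp_le y G (\<lambda>k. \<Sum>j\<in>F. K' k j * f j) C" by (rule lp_boundedE) blast
  have K': "0 \<le> K' k j" for k j
    using assms(4,5)[of k j] c by (metis order.trans mult_le_cancel_left_pos mult_zero_right)
  show ?thesis
  proof (rule lp_boundedI[of "c * C"])
    fix F :: "'b set" and G :: "'a set" and f :: "'b \<Rightarrow> real"
    assume *: "finite F" "finite G" "\<And>j. 0 \<le> f j" "lp_le x F f 1"
    have "lp_le y G (\<lambda>k. c * (\<Sum>j\<in>F. K' k j * f j)) (c * C)"
      using C * c K' by (intro lp_le_scale) (auto intro: sum_nonneg)
    then show "lp_le y G (\<lambda>k. \<Sum>j\<in>F. K k j * f j) (c * C)"
    proof (rule lp_le_mono)
      show "(\<Sum>j\<in>F. K k j * f j) \<le> c * (\<Sum>j\<in>F. K' k j * f j)" for k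
        using assms(5) *(3) unfolding sum_distrib_left mult.assoc[symmetric]
        by (intro sum_mono mult_right_mono) auto
    qed (use assms * in \<open>auto intro: sum_nonneg\<close>)
  qed (use C c in auto)
qed

lemma lp_bounded_add:
  assumes "lp_bounded x y K" "lp_bounded x y L" "0 \<le> y" "y \<le> 1"
    "\<And>k j. 0 \<le> K k j" "\<And>k j. 0 \<le> L k j"
  shows "lp_bounded x y (\<lambda>k j. K k j + L k j)"
proof -
  from assms(1) obtain C where C: "0 \<le> C" "\<And>F G f. \<lbrakk>finite F; finite G; \<And>j. 0 \<le> f j; lp_le x F f 1\<rbrakk>
    \<Longrightarrow> lp_le y G (\<lambda>k. \<Sum>j\<in>F. K k j * f j) C" by (rule lp_boundedE) blast
  from assms(2) obtain E where E: "0 \<le> E" "\<And>F G f. \<lbrakk>finite F; finite G; \<And>j. 0 \<le> f j; lp_le x F f 1\<rbrakk>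
    \<Longrightarrow> lp_le y G (\<lambda>k. \<Sum>j\<in>F. L k j * f j) E" by (rule lp_boundedE) blast
  show ?thesis
  proof (rule lp_boundedI[of "4 * (C + E)"])
    fix F :: "'b set" and G :: "'a set" and f :: "'b \<Rightarrow> real"
    assume *: "finite F" "finite G" "\<And>j. 0 \<le> f j" "lp_le x F f 1"
    show "lp_le y G (\<lambda>k. \<Sum>j\<in>F. (K k j + L k j) * f j) (4 * (C + E))"
      using C E * assms unfolding distrib_right sum.distrib
      by (intro lp_le_add) (auto intro: sum_nonneg)
  qed (use C E in auto)
qed

text \<open>Homogeneity: divide \<open>f\<close> by \<open>D\<close>. For D = 0 this is impossible,
  but then \<open>f\<close> vanishes on \<open>F\<close>.\<close>

lemma lp_bounded_scaledE:
  assumes "lp_bounded x y K" "0 \<le> x" "0 \<le> y" and K0: "\<And>k j. 0 \<le> K k j"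
  obtains C where "0 \<le> C" "\<And>F G f D. \<lbrakk>finite F; finite G; \<And>j. 0 \<le> f j; 0 \<le> D; lp_le x F f D\<rbrakk>
    \<Longrightarrow> lp_le y G (\<lambda>k. \<Sum>j\<in>F. K k j * f j) (C * D)"
proof -
  from assms(1) obtain C where C: "0 \<le> C" "\<And>F G f. \<lbrakk>finite F; finite G; \<And>j. 0 \<le> f j; lp_le x F f 1\<rbrakk>
    \<Longrightarrow> lp_le y G (\<lambda>k. \<Sum>j\<in>F. K k j * f j) C" by (rule lp_boundedE) blast
  have "lp_le y G (\<lambda>k. \<Sum>j\<in>F. K k j * f j) (C * D)"
    if *: "finite F" "finite G" "\<And>j. 0 \<le> f j" "0 \<le> D" "lp_le x F f D" for F G f D
  proof (cases "D = 0")
    case True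
    then have "f j = 0" if "j \<in> F" for j using lp_le_zero[of x F f j] * assms that by auto
    then show ?thesis using True by (simp add: lp_le_def)
  next
    case False
    then have D: "0 < D" using * by simp
    have "lp_le x F (\<lambda>j. (1 / D) * f j) ((1 / D) * D)" using * D by (intro lp_le_scale) auto
    then have "lp_le y G (\<lambda>k. \<Sum>j\<in>F. K k j * ((1 / D) * f j)) C" using * D by (intro C(2)) auto
    then have "lp_le y G (\<lambda>k. D * (\<Sum>j\<in>F. K k j * ((1 / D) * f j))) (D * C)"
      using D C(1) K0 * by (intro lp_le_scale) (auto intro!: sum_nonneg)
    then show ?thesis using D by (simp add: sum_distrib_left mult_ac)
  qed
  with C(1) show thesis by (rule that)
qed

text \<open>A point mass at j, observed at the single point k, returns the entry
  \<open>K k j\<close>.\<close>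

lemma lp_bounded_entry:
  assumes "lp_bounded x y K" "0 \<le> y" "\<And>k j. 0 \<le> K k j"
  obtains C where "0 \<le> C" "\<And>k j. K k j \<le> C"
proof -
  obtain C where C0: "0 \<le> C" and C: "\<And>F G f. \<lbrakk>finite F; finite G; \<And>j. 0 \<le> f j; lp_le x F f 1\<rbrakk>
    \<Longrightarrow> lp_le y G (\<lambda>k. \<Sum>j\<in>F. K k j * f j) C"
    using assms(1) by (rule lp_boundedE) blast
  have "K k j \<le> C" for k j
  proof -
    have "lp_le y {k} (\<lambda>k. \<Sum>j\<in>{j}. K k j * 1) C"
      by (rule C) (auto simp: lp_le_def)
    then show ?thesis using lp_le_point[of y "{k}" _ C k] assms C0 by auto
  qed
  with C0 show thesis by (rule that)
qed

text \<open>The transposed kernel acts between the dual exponents: pair with \<open>f\<close>,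
  exchange the sums, and use Hoelder in one direction and its converse in the other.\<close>

lemma lp_bounded_dual:
  assumes "lp_bounded x y K" "0 \<le> x" "x \<le> 1" "0 \<le> y" "y \<le> 1" and K0: "\<And>k j. 0 \<le> K k j"
  shows "lp_bounded (1 - y) (1 - x) (\<lambda>j k. K k j)"
proof -
  from assms(1) obtain C where C: "0 \<le> C" "\<And>F G f. \<lbrakk>finite F; finite G; \<And>j. 0 \<le> f j; lp_le x F f 1\<rbrakk>
    \<Longrightarrow> lp_le y G (\<lambda>k. \<Sum>j\<in>F. K k j * f j) C" by (rule lp_boundedE) blast
  show ?thesis
  proof (rule lp_boundedI[of C])
    fix G :: "'a set" and F :: "'b set" and g :: "'a \<Rightarrow> real"
    assume *: "finite G" "finite F" "\<And>k. 0 \<le> g k" "lp_le (1 - y) G g 1"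
    show "lp_le (1 - x) F (\<lambda>j. \<Sum>k\<in>G. K k j * g k) C"
    proof (rule lp_le_dual)
      fix f :: "'b \<Rightarrow> real" assume f: "\<And>j. 0 \<le> f j" "lp_le x F f 1"
      have "(\<Sum>j\<in>F. f j * (\<Sum>k\<in>G. K k j * g k)) = (\<Sum>k\<in>G. (\<Sum>j\<in>F. K k j * f j) * g k)"
        unfolding sum_distrib_left sum_distrib_right
        by (subst sum.swap) (simp add: mult_ac)
      also have "\<dots> \<le> C * 1"
        using C f * assms by (intro lp_le_Holder[of y]) (auto intro: sum_nonneg)
      finally show "(\<Sum>j\<in>F. f j * (\<Sum>k\<in>G. K k j * g k)) \<le> C" by simp
    qed (use assms * C in \<open>auto intro: sum_nonneg\<close>)
  qed (use C in auto)
qed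

text \<open>Schur test with a split kernel. Hoelder in j spends \<open>K1\<close> on the row norm
  \<open>M k\<close>; what remains is a weighted average over j of \<open>M k * K2 k j\<close>,
  whose columns are uniformly bounded in norm. The hypothesis y <= x makes the outer power
  convex.\<close>

lemma lp_bounded_Schur:
  assumes xy: "0 \<le> y" "y \<le> x" "x \<le> 1"
    and K1: "\<And>k j. 0 \<le> K1 k j" and K2: "\<And>k j. 0 \<le> K2 k j" and M: "\<And>k. 0 \<le> M k" and C: "0 \<le> C"
    and row: "\<And>k F. finite F \<Longrightarrow> lp_le (1 - x) F (K1 k) (M k)"
    and col: "\<And>j G. finite G \<Longrightarrow> lp_le y G (\<lambda>k. M k * K2 k j) C"
  shows "lp_bounded x y (\<lambda>k j. K1 k j * K2 k j)"
proof (rule lp_boundedI[OF C])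
  fix F :: "'b set" and G :: "'a set" and f :: "'b \<Rightarrow> real"
  assume fin: "finite F" "finite G" and f0: "\<And>j. 0 \<le> f j" and f: "lp_le x F f 1"
  show "lp_le y G (\<lambda>k. \<Sum>j\<in>F. K1 k j * K2 k j * f j) C"
  proof (cases "x = 0")
    case True
    then have y: "y = 0" using xy by simp
    have "(\<Sum>j\<in>F. K1 k j * K2 k j * f j) \<le> C" for k
    proof -
      have *: "sum (K1 k) F \<le> M k" using row[OF fin(1), of k] K1 M True by (simp add: lp_le_1_iff)
      \<comment> \<open>A row with \<open>M k = 0\<close> vanishes in \<open>K1\<close>; otherwise
        the column bound, pointwise since y = 0, can be divided by \<open>M k\<close>.\<close>
      show ?thesis
      proof (cases "M k = 0")
        case True
        then have "sum (K1 k) F = 0" using * by (metis K1 antisym sum_nonneg)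
        then have "\<forall>j\<in>F. K1 k j = 0" using K1 fin by (simp add: sum_nonneg_eq_0_iff)
        then show ?thesis using C by simp
      next
        case False
        then have Mk: "0 < M k" using M[of k] by simp
        have "(\<Sum>j\<in>F. K1 k j * K2 k j * f j) \<le> (\<Sum>j\<in>F. K1 k j * (C / M k) * 1)"
        proof (intro sum_mono mult_mono)
          fix j assume "j \<in> F"
          show "K2 k j \<le> C / M k"
            using col[of "{k}" j] y Mk unfolding lp_le_def by (simp add: field_simps)
          show "f j \<le> 1" using f True \<open>j \<in> F\<close> by (auto simp: lp_le_def)
        qed (use K1 K2 f0 C M in auto)
        also have "\<dots> = sum (K1 k) F * (C / M k)" by (simp add: sum_distrib_right sum_divide_distrib)
        also have "\<dots> \<le> M k * (C / M k)" using * C Mk by (intro mult_right_mono) auto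
        finally show ?thesis using Mk by simp
      qed
    qed
    then show ?thesis using y unfolding lp_le_def by simp
  next
    case False
    then have x0: "0 < x" using xy by simp
    \<comment> \<open>On \<open>F\<close> these weights have total mass at most 1, so they can serve
      in Jensen's inequality with exponent x / y >= 1.\<close>
    define w where "w = (\<lambda>j. f j powr (1 / x))"
    have w: "\<And>j. 0 \<le> w j" "sum w F \<le> 1"
      using f False unfolding w_def lp_le_def by auto
    define b where "b = (\<lambda>k j. (M k * K2 k j) powr (1 / x))"
    have main: "(\<Sum>j\<in>F. K1 k j * K2 k j * f j) \<le> (\<Sum>j\<in>F. w j * b k j) powr x" for k
    proof -
      have "(\<Sum>j\<in>F. K1 k j * K2 k j * f j) = (\<Sum>j\<in>F. (K2 k j * f j) * K1 k j)"
        by (simp add: mult_ac)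
      also have "\<dots> \<le> (\<Sum>j\<in>F. (K2 k j * f j) powr (1 / x)) powr x * M k"
      proof (rule lp_le_Holder[of x])
        show "lp_le x F (\<lambda>j. K2 k j * f j) ((\<Sum>j\<in>F. (K2 k j * f j) powr (1 / x)) powr x)"
          using x0 unfolding lp_le_def by (simp add: powr_powr sum_nonneg)
      qed (use xy fin f0 K1 K2 M row in auto)
      also have "\<dots> = (\<Sum>j\<in>F. (K2 k j * f j) powr (1 / x)) powr x * (M k powr (1 / x)) powr x"
        using M[of k] x0 by (simp add: powr_powr)
      also have "\<dots> = ((\<Sum>j\<in>F. (K2 k j * f j) powr (1 / x)) * M k powr (1 / x)) powr x"
        by (intro powr_mult[symmetric])
      also have "(\<Sum>j\<in>F. (K2 k j * f j) powr (1 / x)) * M k powr (1 / x) = (\<Sum>j\<in>F. w j * b k j)"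
        unfolding sum_distrib_right w_def b_def using K2 f0 M
        by (intro sum.cong) (auto simp: powr_mult mult_ac)
      finally show ?thesis .
    qed
    show ?thesis
    proof (cases "y = 0")
      case True
      have "(\<Sum>j\<in>F. K1 k j * K2 k j * f j) \<le> C" for k
      proof -
        have "(\<Sum>j\<in>F. w j * b k j) \<le> (\<Sum>j\<in>F. w j * C powr (1 / x))"
          unfolding b_def using col[of "{k}"] True M K2 x0 w
          by (intro sum_mono mult_left_mono powr_mono2) (auto simp: lp_le_def)
        also have "\<dots> \<le> 1 * C powr (1 / x)"
          using w unfolding sum_distrib_right[symmetric] by (intro mult_right_mono) auto
        finally have le: "(\<Sum>j\<in>F. w j * b k j) \<le> C powr (1 / x)" by simp
        have "(\<Sum>j\<in>F. w j * b k j) powr x \<le> (C powr (1 / x)) powr x"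
          by (intro powr_mono2 le) (use x0 w in \<open>auto simp: b_def intro!: sum_nonneg\<close>)
        also have "\<dots> = C" using C x0 by (simp add: powr_powr)
        finally show ?thesis using main[of k] by simp
      qed
      then show ?thesis using True unfolding lp_le_def by simp
    next
      case False
      then have y0: "0 < y" using xy by simp
      have "(\<Sum>k\<in>G. (\<Sum>j\<in>F. K1 k j * K2 k j * f j) powr (1 / y))
        \<le> (\<Sum>k\<in>G. \<Sum>j\<in>F. w j * b k j powr (x / y))"
      proof (intro sum_mono)
        fix k
        have "(\<Sum>j\<in>F. K1 k j * K2 k j * f j) powr (1 / y) \<le> ((\<Sum>j\<in>F. w j * b k j) powr x) powr (1 / y)"
          using y0 K1 K2 f0 by (intro powr_mono2 main) (auto intro!: sum_nonneg)
        also have "\<dots> = (\<Sum>j\<in>F. w j * b k j) powr (x / y)" by (simp add: powr_powr)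
        also have "\<dots> \<le> (\<Sum>j\<in>F. w j * b k j powr (x / y))"
          using w y0 xy fin by (intro sum_powr_Jensen) (auto simp: b_def)
        finally show "(\<Sum>j\<in>F. K1 k j * K2 k j * f j) powr (1 / y) \<le> (\<Sum>j\<in>F. w j * b k j powr (x / y))" .
      qed
      also have "\<dots> = (\<Sum>j\<in>F. w j * (\<Sum>k\<in>G. (M k * K2 k j) powr (1 / y)))"
        unfolding sum_distrib_left b_def using x0
        by (subst sum.swap) (simp add: powr_powr)
      also have "\<dots> \<le> (\<Sum>j\<in>F. w j * C powr (1 / y))"
        using col[OF fin(2)] y0 w unfolding lp_le_def by (intro sum_mono mult_left_mono) auto
      also have "\<dots> \<le> 1 * C powr (1 / y)"
        using w unfolding sum_distrib_right[symmetric] by (intro mult_right_mono) auto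
      finally show ?thesis using False unfolding lp_le_def by simp
    qed
  qed
qed

section \<open>Power kernels on spaces of polynomial growth\<close>

text \<open>One framework for two uses: the lattice with the bracket \<open>jbr\<close> in dimension
  \<open>d\<close>, and the naturals with \<open>real a + 1\<close> and d = 1, where the decreasing
  rearrangements live.\<close>

locale poly_growth =
  fixes J :: "'a \<Rightarrow> real" and d c :: real
  assumes J_ge_1: "1 \<le> J i" and d_pos: "0 < d"
    and finite_ball: "finite {i. J i \<le> R}"
    and card_ball: "1 \<le> R \<Longrightarrow> card {i. J i \<le> R} \<le> c * R powr d"
begin

lemma J_pos: "0 < J i"
  using J_ge_1[of i] by linarith

lemma c_nonneg: "0 \<le> c"
proof -
  have "0 \<le> real (card {i. J i \<le> 1})" by simp
  also have "\<dots> \<le> c" using card_ball[of 1] by simp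
  finally show ?thesis .
qed

lemma card_le:
  assumes "S \<subseteq> {i. J i \<le> R}"
  shows "card S \<le> c * R powr d"
proof (cases "1 \<le> R")
  case True
  have "real (card S) \<le> card {i. J i \<le> R}" using assms finite_ball by (simp add: card_mono)
  also have "\<dots> \<le> c * R powr d" using card_ball[OF True] .
  finally show ?thesis .
next
  case False
  then have "S = {}" using order.trans[OF J_ge_1] assms by auto
  then show ?thesis using c_nonneg by simp
qed

lemma powr_dyadic:
  fixes R b :: real
  assumes "0 < R" "R \<le> J i" "J i \<le> 2 * R"
  shows "J i powr b \<le> 2 powr \<bar>b\<bar> * R powr b"
proof (cases "0 \<le> b")
  case True
  then have "J i powr b \<le> (2 * R) powr b" using assms J_pos[of i] by (intro powr_mono2) auto
  then show ?thesis using assms True by (simp add: powr_mult)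
next
  case False
  then have "J i powr b \<le> 1 * R powr b" using assms by (simp add: powr_mono2')
  also have "\<dots> \<le> 2 powr \<bar>b\<bar> * R powr b" by (intro mult_right_mono) (auto intro: ge_one_powr_ge_zero)
  finally show ?thesis .
qed

lemma sum_shell_le:
  assumes "0 < R" "S \<subseteq> {i. R \<le> J i \<and> J i \<le> 2 * R}"
  shows "(\<Sum>i\<in>S. J i powr b) \<le> c * 2 powr (d + \<bar>b\<bar>) * R powr (b + d)"
proof -
  have "(\<Sum>i\<in>S. J i powr b) \<le> (\<Sum>i\<in>S. 2 powr \<bar>b\<bar> * R powr b)"
    using assms by (intro sum_mono powr_dyadic) auto
  also have "\<dots> = card S * (2 powr \<bar>b\<bar> * R powr b)" by simp
  also have "\<dots> \<le> (c * (2 * R) powr d) * (2 powr \<bar>b\<bar> * R powr b)"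
    using assms by (intro mult_right_mono card_le) auto
  also have "\<dots> = c * 2 powr (d + \<bar>b\<bar>) * R powr (b + d)"
    using assms by (simp add: powr_mult powr_add mult_ac)
  finally show ?thesis .
qed

text \<open>Halve \<open>R\<close> repeatedly: the shells form a geometric series dominated by the
  outermost one, because b + d > 0. The induction stops once R < 1, where the ball is empty as J >=
  1.\<close>

lemma sum_low:
  assumes b: "0 < b + d"
  shows "\<exists>C\<ge>0. \<forall>R S. 0 < R \<longrightarrow> S \<subseteq> {i. J i \<le> R} \<longrightarrow> (\<Sum>i\<in>S. J i powr b) \<le> C * R powr (b + d)"
proof -
  define e where "e = b + d"
  have e: "0 < e" using b e_def by simp
  have r: "2 powr (- e) < 1" using e by (simp add: powr_less_one)
  define c' where "c' = c * 2 powr (d + \<bar>b\<bar>) * 2 powr (- e)"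
  \<comment> \<open>The fixed point of C = C 2^(-e) + c', so that one halving step reproduces the
    same constant.\<close>
  define C where "C = c' / (1 - 2 powr (- e))"
  have C0: "0 \<le> C" using r c_nonneg unfolding C_def c'_def by simp
  have "C * (1 - 2 powr (- e)) = c'" using r e unfolding C_def by simp
  then have Ceq: "C * 2 powr (- e) + c' = C" by (simp add: algebra_simps)
  have "(\<Sum>i\<in>S. J i powr b) \<le> C * R powr e"
    if "0 < R" "R < 2 ^ m" "S \<subseteq> {i. J i \<le> R}" for R S and m :: nat
    using that
  proof (induction m arbitrary: R S)
    case 0
    then have "i \<notin> S" for i using J_ge_1[of i] by auto
    then have "S = {}" by blast
    then show ?case using C0 by simp
  next
    case (Suc m)
    let ?T = "{i\<in>S. J i \<le> R / 2}" and ?U = "{i\<in>S. R / 2 < J i}"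
    have fin: "finite S" using Suc.prems finite_ball finite_subset by blast
    have "S = ?T \<union> ?U" by auto
    then have "(\<Sum>i\<in>S. J i powr b) = (\<Sum>i\<in>?T \<union> ?U. J i powr b)" by simp
    also have "\<dots> = (\<Sum>i\<in>?T. J i powr b) + (\<Sum>i\<in>?U. J i powr b)"
      using fin by (intro sum.union_disjoint) auto
    also have "\<dots> \<le> C * (R / 2) powr e + c * 2 powr (d + \<bar>b\<bar>) * (R / 2) powr (b + d)"
      using Suc.prems by (intro add_mono Suc.IH sum_shell_le) auto
    also have "\<dots> = (C * 2 powr (- e) + c') * R powr e"
      using Suc.prems unfolding c'_def e_def[symmetric]
      by (simp add: powr_divide powr_minus_divide field_simps)
    finally show ?case using Ceq by simp
  qed
  moreover have "\<exists>m. R < 2 ^ m" for R :: real by (rule real_arch_pow) simp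
  ultimately show ?thesis using C0 unfolding e_def by blast
qed

text \<open>Doubling \<open>R\<close> instead of halving it: for b + d < 0 the innermost shell
  dominates the geometric series.\<close>

lemma sum_high:
  assumes b: "b + d < 0"
  shows "\<exists>C\<ge>0. \<forall>R S. 0 < R \<longrightarrow> finite S \<longrightarrow> S \<subseteq> {i. R \<le> J i} \<longrightarrow> (\<Sum>i\<in>S. J i powr b) \<le> C * R powr (b + d)"
proof -
  define e where "e = b + d"
  have e: "e < 0" using b e_def by simp
  have r: "2 powr e < 1" using e by (simp add: powr_less_one)
  define c' where "c' = c * 2 powr (d + \<bar>b\<bar>)"
  define C where "C = c' / (1 - 2 powr e)"
  have C0: "0 \<le> C" using r c_nonneg unfolding C_def c'_def by simp
  have "C * (1 - 2 powr e) = c'" using r e unfolding C_def by simp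
  then have Ceq: "c' + C * 2 powr e = C" by (simp add: algebra_simps)
  have main: "(\<Sum>i\<in>S. J i powr b) \<le> C * R powr e"
    if "0 < R" "finite S" "S \<subseteq> {i. R \<le> J i}" "S \<subseteq> {i. J i < R * 2 ^ m}" for R S and m :: nat
    using that
  proof (induction m arbitrary: R S)
    case 0
    then have "S = {}" by force
    then show ?case using C0 by simp
  next
    case (Suc m)
    let ?T = "{i\<in>S. J i \<le> 2 * R}" and ?U = "{i\<in>S. 2 * R < J i}"
    have "S = ?T \<union> ?U" by auto
    then have "(\<Sum>i\<in>S. J i powr b) = (\<Sum>i\<in>?T \<union> ?U. J i powr b)" by simp
    also have "\<dots> = (\<Sum>i\<in>?T. J i powr b) + (\<Sum>i\<in>?U. J i powr b)"
      using Suc.prems by (intro sum.union_disjoint) auto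
    also have "\<dots> \<le> c' * R powr (b + d) + C * (2 * R) powr e"
      unfolding c'_def using Suc.prems
      by (intro add_mono Suc.IH sum_shell_le) (auto simp: mult_ac)
    also have "\<dots> = (c' + C * 2 powr e) * R powr e"
      using Suc.prems unfolding e_def[symmetric] by (simp add: powr_mult algebra_simps)
    finally show ?case using Ceq by simp
  qed
  have "(\<Sum>i\<in>S. J i powr b) \<le> C * R powr e"
    if S: "0 < R" "finite S" "S \<subseteq> {i. R \<le> J i}" for R S
  proof -
    \<comment> \<open>The sum of all \<open>J i\<close> over the finite set \<open>S\<close> bounds
      each of them, which gives a number of doublings after which \<open>S\<close> is
      exhausted.\<close>
    obtain m :: nat where m: "(\<Sum>i\<in>S. J i) / R < 2 ^ m" using real_arch_pow[of 2] by auto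
    have "J i \<le> (\<Sum>i\<in>S. J i)" if "i \<in> S" for i
      using that S J_pos by (intro member_le_sum) (auto intro: less_imp_le)
    then have "S \<subseteq> {i. J i < R * 2 ^ m}"
      using m S by (auto simp: pos_divide_less_eq mult.commute intro: order.strict_trans1)
    then show ?thesis using main S by blast
  qed
  then show ?thesis using C0 unfolding e_def by blast
qed

text \<open>For z > 0 this is \<open>sum_low\<close> with exponent b / z; for z = 0 it is
  monotonicity of the power.\<close>

lemma lp_le_low:
  assumes "0 \<le> z" "0 < b + d * z"
  shows "\<exists>C\<ge>0. \<forall>R S. 0 < R \<longrightarrow> S \<subseteq> {i. J i \<le> R} \<longrightarrow> lp_le z S (\<lambda>i. J i powr b) (C * R powr (b + d * z))"
proof (cases "z = 0")
  case True
  then have "lp_le z S (\<lambda>i. J i powr b) (1 * R powr (b + d * z))" if "S \<subseteq> {i. J i \<le> R}" for R S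
    using assms that J_pos unfolding lp_le_def by (auto intro!: powr_mono2 intro: less_imp_le[OF J_pos])
  then show ?thesis by (intro exI[of _ 1]) auto
next
  case False
  then have z: "0 < z" using assms by simp
  then have "0 < b / z + d" using assms by (simp add: field_simps)
  from sum_low[OF this] obtain C where C: "0 \<le> C"
    "\<And>R S. \<lbrakk>0 < R; S \<subseteq> {i. J i \<le> R}\<rbrakk> \<Longrightarrow> (\<Sum>i\<in>S. J i powr (b / z)) \<le> C * R powr (b / z + d)" by blast
  have "lp_le z S (\<lambda>i. J i powr b) (C powr z * R powr (b + d * z))" if "0 < R" "S \<subseteq> {i. J i \<le> R}" for R S
    using C(2)[OF that] z C(1) by (simp add: lp_le_def powr_mult powr_powr add_divide_distrib)
  then show ?thesis by (intro exI[of _ "C powr z"]) auto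
qed

lemma lp_le_high:
  assumes "0 \<le> z" "b + d * z < 0"
  shows "\<exists>C\<ge>0. \<forall>R S. 0 < R \<longrightarrow> finite S \<longrightarrow> S \<subseteq> {i. R \<le> J i} \<longrightarrow> lp_le z S (\<lambda>i. J i powr b) (C * R powr (b + d * z))"
proof (cases "z = 0")
  case True
  then have "lp_le z S (\<lambda>i. J i powr b) (1 * R powr (b + d * z))" if "0 < R" "S \<subseteq> {i. R \<le> J i}" for R S
    using assms that unfolding lp_le_def by (auto intro!: powr_mono2')
  then show ?thesis by (intro exI[of _ 1]) auto
next
  case False
  then have z: "0 < z" using assms by simp
  then have "b / z + d < 0" using assms by (simp add: field_simps)
  from sum_high[OF this] obtain C where C: "0 \<le> C"
    "\<And>R S. \<lbrakk>0 < R; finite S; S \<subseteq> {i. R \<le> J i}\<rbrakk> \<Longrightarrow> (\<Sum>i\<in>S. J i powr (b / z)) \<le> C * R powr (b / z + d)" by blast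
  have "lp_le z S (\<lambda>i. J i powr b) (C powr z * R powr (b + d * z))" if "0 < R" "finite S" "S \<subseteq> {i. R \<le> J i}" for R S
    using C(2)[OF that] z C(1) by (simp add: lp_le_def powr_mult powr_powr add_divide_distrib)
  then show ?thesis by (intro exI[of _ "C powr z"]) auto
qed

text \<open>A Hardy-type kernel. The factor in j is split as J(j)^w J(j)^(-a), with w just summable
  in the row norm. The rows then decay like J(k)^(-a), and the column sums over J(k) <= J(j) grow
  like J(j)^a, which the second factor cancels.\<close>

lemma lp_bounded_upper:
  assumes xy: "0 \<le> y" "y \<le> x" "x \<le> 1" and uv: "u + v \<le> - d * (1 - x + y)" "v < - d * (1 - x)"
  shows "lp_bounded x y (\<lambda>k j. if J k \<le> J j then J k powr u * J j powr v else 0)"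
proof -
  \<comment> \<open>Raising u makes the kernel homogeneous of the critical degree; a is then half of
    the remaining room on either side of the Schur test.\<close>
  define u' where "u' = - d * (1 - x + y) - v"
  define a where "a = (u' + d * y) / 2"
  have a: "0 < a" using uv unfolding a_def u'_def by (simp add: algebra_simps)
  have a2: "u' + d * y = 2 * a" "v + d * (1 - x) + a = - a" unfolding a_def u'_def by (auto simp: algebra_simps)
  define w where "w = - d * (1 - x) - a"
  have "w + d * (1 - x) = - a" by (simp add: w_def algebra_simps)
  with lp_le_high[of "1 - x" w] obtain C1 where C1_0: "0 \<le> C1" and C1:
    "\<And>R S. \<lbrakk>0 < R; finite S; S \<subseteq> {i. R \<le> J i}\<rbrakk> \<Longrightarrow> lp_le (1 - x) S (\<lambda>i. J i powr w) (C1 * R powr (- a))"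
    using xy(3) a by (metis diff_ge_0_iff_ge neg_less_0_iff_less)
  have "u' - a + d * y = a" using a2 by simp
  with lp_le_low[of y "u' - a"] obtain C2 where C2_0: "0 \<le> C2" and C2:
    "\<And>R S. \<lbrakk>0 < R; S \<subseteq> {i. J i \<le> R}\<rbrakk> \<Longrightarrow> lp_le y S (\<lambda>i. J i powr (u' - a)) (C2 * R powr a)"
    using xy(1) a by metis
  define K1 where "K1 = (\<lambda>k j. if J k \<le> J j then J j powr w else 0)"
  define K2 where "K2 = (\<lambda>k j. if J k \<le> J j then J k powr u' * J j powr (- a) else 0)"
  have "lp_bounded x y (\<lambda>k j. K1 k j * K2 k j)"
  proof (rule lp_bounded_Schur[where M = "\<lambda>k. C1 * J k powr (- a)" and C = "C1 * C2"])
    show "lp_le (1 - x) F (K1 k) (C1 * J k powr (- a))" if "finite F" for k F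
    proof -
      have "lp_le (1 - x) {j\<in>F. J k \<le> J j} (\<lambda>j. J j powr w) (C1 * J k powr (- a))"
        by (intro C1 J_pos) (use that in auto)
      then show ?thesis unfolding K1_def using that C1_0 by (subst lp_le_filter) simp_all
    qed
    show "lp_le y G (\<lambda>k. C1 * J k powr (- a) * K2 k j) (C1 * C2)" if "finite G" for j G
    proof -
      have "lp_le y {k\<in>G. J k \<le> J j} (\<lambda>k. (C1 * J j powr (- a)) * J k powr (u' - a)) ((C1 * J j powr (- a)) * (C2 * J j powr a))"
        by (intro lp_le_scale C2 J_pos) (use C1_0 C2_0 in simp_all, blast)
      also have "(C1 * J j powr (- a)) * (C2 * J j powr a) = C1 * C2"
        using J_pos[of j] by (simp add: powr_minus_divide)
      finally have "lp_le y G (\<lambda>k. if J k \<le> J j then (C1 * J j powr (- a)) * J k powr (u' - a) else 0) (C1 * C2)"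
        using that C1_0 C2_0 by (subst lp_le_filter) simp_all
      also have "(\<lambda>k. if J k \<le> J j then (C1 * J j powr (- a)) * J k powr (u' - a) else 0) = (\<lambda>k. C1 * J k powr (- a) * K2 k j)"
      proof
        fix k
        have "J k powr (u' - a) = J k powr u' * J k powr (- a)"
          by (simp flip: powr_add)
        then show "(if J k \<le> J j then (C1 * J j powr (- a)) * J k powr (u' - a) else 0) = C1 * J k powr (- a) * K2 k j"
          unfolding K2_def by simp
      qed
      finally show ?thesis .
    qed
  qed (use xy C1_0 C2_0 in \<open>auto simp: K1_def K2_def\<close>)
  then show ?thesis
  proof (rule lp_bounded_mono[where c = 1])
    show "(if J k \<le> J j then J k powr u * J j powr v else 0) \<le> 1 * (K1 k j * K2 k j)" for k j
    proof (cases "J k \<le> J j")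
      case True
      have "J k powr u * J j powr v \<le> J k powr u' * J j powr v"
        using J_ge_1 uv unfolding u'_def by (intro mult_right_mono powr_mono) auto
      moreover have "J j powr v = J j powr w * J j powr (- a)"
      proof -
        have "v = w + - a" using a2 unfolding w_def by (simp add: algebra_simps)
        then show ?thesis by (simp only: powr_add)
      qed
      ultimately show ?thesis using True by (simp add: K1_def K2_def mult_ac)
    qed (simp add: K1_def)
  qed (use xy in auto)
qed

text \<open>The transpose of \<open>lp_bounded_upper\<close>: x and y become 1 - y and 1 - x, and
  the exponents u and v change places.\<close>

lemma lp_bounded_lower:
  assumes xy: "0 \<le> y" "y \<le> x" "x \<le> 1" and uv: "u + v \<le> - d * (1 - x + y)" "u < - d * y"
  shows "lp_bounded x y (\<lambda>k j. if J j \<le> J k then J k powr u * J j powr v else 0)"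
proof -
  have "lp_bounded (1 - y) (1 - x) (\<lambda>j k. if J j \<le> J k then J j powr v * J k powr u else 0)"
  proof (rule lp_bounded_upper)
    show "v + u \<le> - d * (1 - (1 - y) + (1 - x))" using uv(1) by (simp add: algebra_simps)
    show "u < - d * (1 - (1 - y))" using uv(2) by simp
  qed (use xy in auto)
  then have "lp_bounded (1 - (1 - x)) (1 - (1 - y)) (\<lambda>k j. if J j \<le> J k then J j powr v * J k powr u else 0)"
    by (rule lp_bounded_dual) (use xy in auto)
  then show ?thesis by (subst (asm) mult.commute) simp
qed

end

section \<open>Groups of polynomial growth and the Hardy--Littlewood--Sobolev inequality\<close>

locale group_growth = poly_growth J d c for J :: "'a::ab_group_add \<Rightarrow> real" and d c +
  assumes J_minus: "J (- i) = J i" and J_add: "J (i + j) \<le> J i + J j"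
begin

lemma J_diff_commute: "J (k - j) = J (j - k)"
  using J_minus[of "k - j"] by simp

lemma J_diff_le: "J (k - j) \<le> J k + J j"
  using J_add[of k "- j"] by (simp add: J_minus)

lemma J_le_add_diff: "J k \<le> J j + J (k - j)"
  using J_add[of j "k - j"] by simp

lemma lp_le_translate:
  assumes "lp_le z ((\<lambda>i. k - i) ` F) (\<lambda>i. J i powr b) D"
  shows "lp_le z F (\<lambda>i. J (k - i) powr b) D" "lp_le z F (\<lambda>i. J (i - k) powr b) D"
proof -
  show "lp_le z F (\<lambda>i. J (k - i) powr b) D"
    using assms by (subst (asm) lp_le_reindex) (auto simp: inj_on_def)
  then show "lp_le z F (\<lambda>i. J (i - k) powr b) D" by (simp add: J_diff_commute)
qed

text \<open>A Young-type bound below the critical exponent: half of the surplus decay goes to the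
  row factor \<open>g1\<close> and half to the column factor \<open>g2\<close>, making both summable
  over the whole group.\<close>

lemma lp_bounded_convolution:
  assumes xy: "0 \<le> y" "y \<le> x" "x \<le> 1" and g: "g < - d * (1 - x + y)"
  shows "lp_bounded x y (\<lambda>k j. J (k - j) powr g)"
proof -
  define e where "e = (- d * (1 - x + y) - g) / 2"
  define g1 where "g1 = - d * (1 - x) - e"
  define g2 where "g2 = - d * y - e"
  have e: "0 < e" "g = g1 + g2" using g unfolding e_def g1_def g2_def by (auto simp: field_simps)
  have "g1 + d * (1 - x) < 0" "g2 + d * y < 0" using e unfolding g1_def g2_def by auto
  with lp_le_high[of "1 - x" g1] lp_le_high[of y g2] xy
  obtain C1 C2 where C1_0: "0 \<le> C1" and C1: "\<And>R S. \<lbrakk>0 < R; finite S; S \<subseteq> {i. R \<le> J i}\<rbrakk>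
      \<Longrightarrow> lp_le (1 - x) S (\<lambda>i. J i powr g1) (C1 * R powr (g1 + d * (1 - x)))"
    and C2_0: "0 \<le> C2" and C2: "\<And>R S. \<lbrakk>0 < R; finite S; S \<subseteq> {i. R \<le> J i}\<rbrakk>
      \<Longrightarrow> lp_le y S (\<lambda>i. J i powr g2) (C2 * R powr (g2 + d * y))"
    by (metis diff_ge_0_iff_ge)
  have "lp_bounded x y (\<lambda>k j. J (k - j) powr g1 * J (k - j) powr g2)"
  proof (rule lp_bounded_Schur[where M = "\<lambda>_. C1" and C = "C1 * C2"])
    show "lp_le (1 - x) F (\<lambda>j. J (k - j) powr g1) C1" if "finite F" for k F
      using C1[of 1 "(\<lambda>i. k - i) ` F"] that J_ge_1 by (intro lp_le_translate) auto
    show "lp_le y G (\<lambda>k. C1 * J (k - j) powr g2) (C1 * C2)" if "finite G" for j G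
    proof (rule lp_le_scale)
      show "lp_le y G (\<lambda>k. J (k - j) powr g2) C2"
        using C2[of 1 "(\<lambda>i. j - i) ` G"] that J_ge_1 by (intro lp_le_translate) auto
    qed (use C1_0 C2_0 in auto)
  qed (use xy C1_0 C2_0 in auto)
  then show ?thesis by (simp add: e(2) powr_add)
qed

text \<open>On the comparable region J(k - j) <= 3 J(k), so row and column sums run over balls. Each
  grows like the power e = w / 2 of the radius, and the weight J(k)^(-w) absorbs the
  product.\<close>

lemma lp_bounded_diagonal:
  assumes xy: "0 \<le> y" "y \<le> x" "x \<le> 1" and w: "0 < w" "w + g = d * (1 - x + y)"
  shows "lp_bounded x y (\<lambda>k j. if J k \<le> 2 * J j \<and> J j \<le> 2 * J k then J k powr (- w) * J (k - j) powr (- g) else 0)"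
proof -
  define e where "e = w / 2"
  define g1 where "g1 = - d * (1 - x) + e"
  define g2 where "g2 = - d * y + e"
  have e: "0 < e" "w = 2 * e" using w unfolding e_def by auto
  have g: "- g = g1 + g2" using w(2) unfolding g1_def g2_def e_def by (simp add: algebra_simps)
  have g12: "g1 + d * (1 - x) = e" "g2 + d * y = e" unfolding g1_def g2_def by auto
  with lp_le_low[of "1 - x" g1] lp_le_low[of y g2] xy e
  obtain C1 C2 where C1_0: "0 \<le> C1" and C1: "\<And>R S. \<lbrakk>0 < R; S \<subseteq> {i. J i \<le> R}\<rbrakk>
      \<Longrightarrow> lp_le (1 - x) S (\<lambda>i. J i powr g1) (C1 * R powr e)"
    and C2_0: "0 \<le> C2" and C2: "\<And>R S. \<lbrakk>0 < R; S \<subseteq> {i. J i \<le> R}\<rbrakk>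
      \<Longrightarrow> lp_le y S (\<lambda>i. J i powr g2) (C2 * R powr e)"
    by (metis diff_ge_0_iff_ge)
  define P where "P = (\<lambda>k j. J k \<le> 2 * J j \<and> J j \<le> 2 * J k)"
  have P1: "J (k - j) \<le> 3 * J k" if "P k j" for k j
    using J_diff_le[of k j] that unfolding P_def by auto
  have P2: "J (j - k) \<le> 3 * J j" if "P k j" for k j
    using J_diff_le[of j k] that unfolding P_def by auto
  define K1 where "K1 = (\<lambda>k j. if P k j then J (k - j) powr g1 else 0)"
  define K2 where "K2 = (\<lambda>k j. if P k j then J k powr (- w) * J (k - j) powr g2 else 0)"
  have "lp_bounded x y (\<lambda>k j. K1 k j * K2 k j)"
  proof (rule lp_bounded_Schur[where M = "\<lambda>k. C1 * (3 * J k) powr e" and C = "C1 * 3 powr e * 2 powr e * (C2 * 3 powr e)"])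
    show "lp_le (1 - x) F (K1 k) (C1 * (3 * J k) powr e)" if "finite F" for k F
    proof -
      have "lp_le (1 - x) {j\<in>F. P k j} (\<lambda>j. J (k - j) powr g1) (C1 * (3 * J k) powr e)"
        using C1[of "3 * J k" "(\<lambda>j. k - j) ` {j\<in>F. P k j}"] P1 J_pos[of k] by (intro lp_le_translate) auto
      then show ?thesis unfolding K1_def using that C1_0 by (subst lp_le_filter) simp_all
    qed
    show "lp_le y G (\<lambda>k. C1 * (3 * J k) powr e * K2 k j) (C1 * 3 powr e * 2 powr e * (C2 * 3 powr e))" if "finite G" for j G
    proof -
      define B where "B = C1 * 3 powr e * (2 powr e * J j powr (- e))"
      have B0: "0 \<le> B" using C1_0 unfolding B_def by simp
      have "lp_le y {k\<in>G. P k j} (\<lambda>k. J (k - j) powr g2) (C2 * (3 * J j) powr e)"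
        using C2[of "3 * J j" "(\<lambda>k. j - k) ` {k\<in>G. P k j}"] P2 J_pos[of j] by (intro lp_le_translate) auto
      then have "lp_le y {k\<in>G. P k j} (\<lambda>k. B * J (k - j) powr g2) (B * (C2 * (3 * J j) powr e))"
        by (rule lp_le_scale) (use B0 C2_0 in auto)
      also have "B * (C2 * (3 * J j) powr e) = C1 * 3 powr e * 2 powr e * (C2 * 3 powr e)"
        using J_pos[of j] unfolding B_def by (simp add: powr_mult powr_minus_divide)
      finally have "lp_le y G (\<lambda>k. if P k j then B * J (k - j) powr g2 else 0) (C1 * 3 powr e * 2 powr e * (C2 * 3 powr e))"
        using that C1_0 C2_0 by (subst lp_le_filter) simp_all
      then show ?thesis
      proof (rule lp_le_mono)
        fix k
        show "C1 * (3 * J k) powr e * K2 k j \<le> (if P k j then B * J (k - j) powr g2 else 0)"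
        proof (cases "P k j")
          case True
          have "(3 * J k) powr e * J k powr (- w) = 3 powr e * J k powr (- e)"
            using J_pos[of k] by (simp add: powr_mult e(2) flip: powr_add)
          also have "\<dots> \<le> 3 powr e * (J j / 2) powr (- e)"
            using True J_pos[of j] e unfolding P_def by (intro mult_left_mono powr_mono2') auto
          also have "(J j / 2) powr (- e) = 2 powr e * J j powr (- e)"
            using J_pos[of j] by (simp add: powr_divide powr_minus_divide)
          finally have "C1 * ((3 * J k) powr e * J k powr (- w)) * J (k - j) powr g2
              \<le> C1 * (3 powr e * (2 powr e * J j powr (- e))) * J (k - j) powr g2"
            using C1_0 by (intro mult_right_mono mult_left_mono) auto
          then show ?thesis using True unfolding K2_def B_def by (simp add: mult.assoc)
        qed (simp add: K2_def)
      qed (use xy C1_0 in \<open>auto simp: K2_def\<close>)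
    qed
  qed (use xy C1_0 C2_0 in \<open>auto simp: K1_def K2_def\<close>)
  also have "(\<lambda>k j. K1 k j * K2 k j) = (\<lambda>k j. if P k j then J k powr (- w) * J (k - j) powr (- g) else 0)"
    by (auto simp: fun_eq_iff K1_def K2_def g powr_add)
  finally show ?thesis unfolding P_def .
qed

text \<open>Near \<open>j\<close> the sum over a ball applies; far from \<open>j\<close> every term
  is at most R^(d (th - 1)) and there are at most |G| of them.\<close>

lemma sum_near_far:
  assumes th: "0 < th" "th < 1"
  shows "\<exists>C\<ge>0. \<forall>G j. finite G \<longrightarrow> (\<Sum>k\<in>G. J (k - j) powr (d * (th - 1))) \<le> C * real (card G) powr th"
proof -
  let ?g = "d * (th - 1)"
  have gd: "?g + d = d * th" by (simp add: algebra_simps)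
  have "0 < ?g + d" using th d_pos unfolding gd by simp
  from sum_low[OF this] obtain C where C0: "0 \<le> C"
    and C: "\<And>R S. \<lbrakk>0 < R; S \<subseteq> {i. J i \<le> R}\<rbrakk> \<Longrightarrow> (\<Sum>i\<in>S. J i powr ?g) \<le> C * R powr (d * th)"
    unfolding gd by blast
  have "(\<Sum>k\<in>G. J (k - j) powr ?g) \<le> (C + 1) * real (card G) powr th" if fin: "finite G" for G j
  proof (cases "G = {}")
    case False
    define N where "N = real (card G)"
    have N: "0 < N" using False fin unfolding N_def by (simp add: card_gt_0_iff)
    \<comment> \<open>The radius at which a ball has about |G| points; near and far parts are then
      both of order |G|^th.\<close>
    define R where "R = N powr (1 / d)"
    have R: "0 < R" using N unfolding R_def by simp
    let ?T = "{k\<in>G. J (k - j) \<le> R}" and ?U = "{k\<in>G. R < J (k - j)}"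
    have "G = ?T \<union> ?U" by auto
    then have "(\<Sum>k\<in>G. J (k - j) powr ?g) = (\<Sum>k\<in>?T \<union> ?U. J (k - j) powr ?g)" by simp
    also have "\<dots> = (\<Sum>k\<in>?T. J (k - j) powr ?g) + (\<Sum>k\<in>?U. J (k - j) powr ?g)"
      using fin by (intro sum.union_disjoint) auto
    also have "(\<Sum>k\<in>?T. J (k - j) powr ?g) = (\<Sum>i\<in>(\<lambda>k. k - j) ` ?T. J i powr ?g)"
      by (subst sum.reindex) (auto simp: inj_on_def)
    also have "\<dots> \<le> C * R powr (d * th)" using R by (intro C) auto
    also have "R powr (d * th) = N powr th" using d_pos unfolding R_def by (simp add: powr_powr)
    also have "(\<Sum>k\<in>?U. J (k - j) powr ?g) \<le> (\<Sum>k\<in>?U. R powr ?g)"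
      using R d_pos th by (intro sum_mono powr_mono2') (auto simp: mult_le_0_iff)
    also have "\<dots> = card ?U * R powr ?g" by simp
    also have "\<dots> \<le> N * R powr ?g"
      unfolding N_def using fin by (intro mult_right_mono) (auto intro!: card_mono)
    also have "R powr ?g = N powr (th - 1)" using d_pos unfolding R_def by (simp add: powr_powr)
    also have "N * N powr (th - 1) = N powr th" using N by (simp add: powr_diff)
    finally show ?thesis unfolding N_def by (simp add: algebra_simps)
  qed auto
  then show ?thesis using C0 by (intro exI[of _ "C + 1"]) auto
qed

end

section \<open>Decreasing rearrangement and the critical convolution kernel\<close>

text \<open>Summation by parts: pairing with a decreasing nonnegative sequence preserves the order
  of partial sums. The induction keeps the last value of \<open>f\<close> times the full partial sum
  as a lower bound.\<close>

lemma sum_majorization: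
  fixes f h w :: "nat \<Rightarrow> real"
  assumes dec: "\<And>a b. a \<le> b \<Longrightarrow> b < N \<Longrightarrow> f b \<le> f a" and f0: "\<And>a. 0 \<le> f a"
    and part: "\<And>m. m \<le> N \<Longrightarrow> (\<Sum>a<m. h a) \<le> (\<Sum>a<m. w a)"
  shows "(\<Sum>a<N. f a * h a) \<le> (\<Sum>a<N. f a * w a)"
proof (cases N)
  case (Suc n)
  have "f m * (\<Sum>a<Suc m. w a - h a) \<le> (\<Sum>a<Suc m. f a * (w a - h a))" if "m < N" for m
    using that
  proof (induction m)
    case (Suc m)
    have "0 \<le> (\<Sum>a<Suc m. w a - h a)" using part[of "Suc m"] Suc.prems by (simp add: sum_subtractf)
    then have "f (Suc m) * (\<Sum>a<Suc m. w a - h a) \<le> f m * (\<Sum>a<Suc m. w a - h a)"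
      using dec[of m "Suc m"] Suc.prems by (intro mult_right_mono) auto
    also have "\<dots> \<le> (\<Sum>a<Suc m. f a * (w a - h a))" using Suc by simp
    finally show ?case by (simp add: distrib_left)
  qed simp
  from this[of n] have "f n * (\<Sum>a<N. w a - h a) \<le> (\<Sum>a<N. f a * (w a - h a))" using Suc by simp
  moreover have "0 \<le> f n * (\<Sum>a<N. w a - h a)" using part[of N] f0 by (simp add: sum_subtractf)
  ultimately show ?thesis by (simp add: right_diff_distrib sum_subtractf)
qed simp

lemma ex_decreasing_enumeration:
  fixes f :: "'a \<Rightarrow> real"
  assumes "finite F"
  obtains e where "bij_betw e {..<card F} F" "\<And>a b. a \<le> b \<Longrightarrow> b < card F \<Longrightarrow> f (e b) \<le> f (e a)"
proof -
  obtain xs where xs: "set xs = F" "distinct xs" using finite_distinct_list[OF assms] by blast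
  define ys where "ys = sort_key (\<lambda>x. - f x) xs"
  have ys: "set ys = F" "distinct ys" "length ys = card F"
    using xs distinct_card[OF xs(2)] unfolding ys_def by auto
  have "sorted (map (\<lambda>x. - f x) ys)" unfolding ys_def by simp
  then have "f (ys ! b) \<le> f (ys ! a)" if "a \<le> b" "b < card F" for a b
    using that ys(3) sorted_nth_mono[of "map (\<lambda>x. - f x) ys" a b] by simp
  moreover have "bij_betw (nth ys) {..<card F} F"
    using bij_betw_nth[of ys] ys by simp
  ultimately show thesis using that by blast
qed

lemma nat_poly_growth: "poly_growth (\<lambda>a::nat. real a + 1) 1 1"
proof
  have sub: "{a. real a + 1 \<le> R} \<subseteq> {..<nat \<lfloor>R\<rfloor>}" for R
    by (auto simp: nat_less_iff zless_nat_eq_int_zless less_floor_iff)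
  show "finite {a. real a + 1 \<le> R}" for R by (rule finite_subset[OF sub]) simp
  show "real (card {a. real a + 1 \<le> R}) \<le> 1 * R powr 1" if "1 \<le> R" for R
  proof -
    have "card {a. real a + 1 \<le> R} \<le> nat \<lfloor>R\<rfloor>" using card_mono[OF _ sub] by simp
    then have "real (card {a. real a + 1 \<le> R}) \<le> real (nat \<lfloor>R\<rfloor>)" by simp
    also have "\<dots> \<le> R" using that by linarith
    finally show ?thesis using that by simp
  qed
qed auto

text \<open>The maximum splits into an upper kernel with exponents (0, th - 1) and a lower one with
  (th - 1, 0). Both have critical total degree; the strict side conditions are exactly 0 < y and x <
  1.\<close>

lemma lp_bounded_rank_kernel:
  assumes "0 < y" "x < 1" "th = x - y" "0 < th"
  shows "lp_bounded x y (\<lambda>b a. max (real a + 1) (real b + 1) powr (th - 1))"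
proof -
  interpret poly_growth "\<lambda>a::nat. real a + 1" 1 1 by (rule nat_poly_growth)
  let ?J = "\<lambda>a::nat. real a + 1"
  have "lp_bounded x y (\<lambda>k j. (if ?J k \<le> ?J j then ?J k powr 0 * ?J j powr (th - 1) else 0)
      + (if ?J j \<le> ?J k then ?J k powr (th - 1) * ?J j powr 0 else 0))"
    using assms by (intro lp_bounded_add lp_bounded_upper lp_bounded_lower) auto
  then show ?thesis
    by (rule lp_bounded_mono[where c = 1]) (use assms in \<open>auto simp: max_def\<close>)
qed

text \<open>Norms depend only on the decreasing rearrangements, so it suffices to dominate the
  rearranged output by the rank kernel \<open>W\<close> applied to the rearranged input. The kernel
  enters only through its sums over finite sets.\<close>

lemma (in group_growth) lp_bounded_HLS:
  assumes "0 < y" "x < 1" "th = x - y" "0 < th"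
  shows "lp_bounded x y (\<lambda>k j. J (k - j) powr (d * (th - 1)))"
proof -
  have th1: "th < 1" using assms by simp
  define K where "K = (\<lambda>k j. J (k - j) powr (d * (th - 1)))"
  have K0: "0 \<le> K k j" for k j unfolding K_def by simp
  define W where "W = (\<lambda>b a. max (real a + 1) (real b + 1) powr (th - 1))"
  obtain C where C0: "0 \<le> C" and C: "\<And>G j. finite G \<Longrightarrow> (\<Sum>k\<in>G. K k j) \<le> C * real (card G) powr th"
    using sum_near_far[OF assms(4) th1] unfolding K_def by blast
  have C': "(\<Sum>j\<in>F. K k j) \<le> C * real (card F) powr th" if "finite F" for F k
    using C[OF that, of k] unfolding K_def by (simp add: J_diff_commute)
  obtain C2 where C2_0: "0 \<le> C2" and C2: "\<And>F G f. \<lbrakk>finite F; finite G; \<And>j. 0 \<le> f j; lp_le x F f 1\<rbrakk>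
    \<Longrightarrow> lp_le y G (\<lambda>b. \<Sum>a\<in>F. W b a * f a) C2"
    using lp_bounded_rank_kernel[OF assms] unfolding W_def by (rule lp_boundedE) blast
  have "lp_bounded x y K"
  proof (rule lp_boundedI[of "C * C2"])
    fix F G :: "'a set" and f :: "'a \<Rightarrow> real"
    assume fin: "finite F" "finite G" and f0: "\<And>j. 0 \<le> f j" and f: "lp_le x F f 1"
    define g where "g = (\<lambda>k. \<Sum>j\<in>F. K k j * f j)"
    have g0: "0 \<le> g k" for k unfolding g_def using K0 f0 by (intro sum_nonneg) auto
    obtain e where e: "bij_betw e {..<card F} F" "\<And>a b. a \<le> b \<Longrightarrow> b < card F \<Longrightarrow> f (e b) \<le> f (e a)"
      using ex_decreasing_enumeration[OF fin(1)] by blast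
    obtain h where h: "bij_betw h {..<card G} G" "\<And>a b. a \<le> b \<Longrightarrow> b < card G \<Longrightarrow> g (h b) \<le> g (h a)"
      using ex_decreasing_enumeration[OF fin(2)] by blast
    have inj: "inj_on e {..<card F}" "inj_on h {..<card G}" and im: "e ` {..<card F} = F" "h ` {..<card G} = G"
      using e(1) h(1) by (auto simp: bij_betw_def)
    have main: "g (h b) \<le> C * (\<Sum>a<card F. W b a * f (e a))" if b: "b < card G" for b
    proof -
      \<comment> \<open>The b + 1 points where \<open>g\<close> is largest; \<open>g (h b)\<close>
        is at most the average of \<open>g\<close> over them.\<close>
      define B where "B = h ` {..b}"
      have injb: "inj_on h {..b}" using inj(2) by (rule inj_on_subset) (use b in auto)
      have B: "finite B" "card B = Suc b" unfolding B_def using injb by (auto simp: card_image)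
      define H where "H = (\<lambda>a. \<Sum>k\<in>B. K k (e a))"
      have "real (Suc b) * g (h b) = (\<Sum>i\<le>b. g (h b))" by simp
      also have "\<dots> \<le> (\<Sum>i\<le>b. g (h i))" using b by (intro sum_mono h(2)) auto
      also have "\<dots> = (\<Sum>k\<in>B. g k)" unfolding B_def using injb by (simp add: sum.reindex)
      also have "\<dots> = (\<Sum>j\<in>F. f j * (\<Sum>k\<in>B. K k j))"
        unfolding g_def sum_distrib_left by (subst sum.swap) (simp add: mult.commute)
      also have "\<dots> = (\<Sum>a<card F. f (e a) * H a)"
        unfolding H_def using sum.reindex[OF inj(1), of "\<lambda>j. f j * (\<Sum>k\<in>B. K k j)"] im(1) by simp
      \<comment> \<open>Only the partial sums of H are controlled; that suffices because f is decreasing along e.\<close>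
      also have "\<dots> \<le> (\<Sum>a<card F. f (e a) * (C * real (Suc b) * W b a))"
      proof (rule sum_majorization[OF e(2) f0])
        fix m assume m: "m \<le> card F"
        define E where "E = e ` {..<m}"
        have inje: "inj_on e {..<m}" using inj(1) by (rule inj_on_subset) (use m in auto)
        have E: "finite E" "card E = m" unfolding E_def using inje by (auto simp: card_image)
        define S where "S = (\<Sum>a<m. H a)"
        have S1: "S = (\<Sum>j\<in>E. \<Sum>k\<in>B. K k j)"
          unfolding S_def H_def E_def using inje by (simp add: sum.reindex)
        have le1: "S \<le> real m * (C * real (Suc b) powr th)"
        proof -
          have "S \<le> (\<Sum>j\<in>E. C * real (Suc b) powr th)"
            unfolding S1 using C[OF B(1)] B(2) by (intro sum_mono) simp
          then show ?thesis using E by simp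
        qed
        have le2: "S \<le> real (Suc b) * (C * real m powr th)"
        proof -
          have "S = (\<Sum>k\<in>B. \<Sum>j\<in>E. K k j)" unfolding S1 by (rule sum.swap)
          also have "\<dots> \<le> (\<Sum>k\<in>B. C * real m powr th)"
            using C'[OF E(1)] E(2) by (intro sum_mono) simp
          finally show ?thesis using B by simp
        qed
        \<comment> \<open>Both orders of summation bound the double sum over \<open>E\<close> and
          \<open>B\<close>; the better one is that whose inner sum runs over the smaller set, and it
          produces the maximum of the two sizes.\<close>
        have "S \<le> C * real (Suc b) * (real m * max (real m) (real (Suc b)) powr (th - 1))"
        proof (cases "m \<le> Suc b")
          case True
          have "real (Suc b) powr th = real (Suc b) * real (Suc b) powr (th - 1)" by (simp add: powr_diff)
          then show ?thesis using le1 True by (simp add: max_def mult_ac)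
        next
          case False
          then have "real m powr th = real m * real m powr (th - 1)" by (simp add: powr_diff)
          then show ?thesis using le2 False by (simp add: max_def mult_ac)
        qed
        also have "\<dots> \<le> C * real (Suc b) * (\<Sum>a<m. W b a)"
        proof (intro mult_left_mono)
          have "real m * max (real m) (real (Suc b)) powr (th - 1) = (\<Sum>a<m. max (real m) (real (Suc b)) powr (th - 1))"
            by simp
          also have "\<dots> \<le> (\<Sum>a<m. W b a)"
            unfolding W_def using th1 by (intro sum_mono powr_mono2') auto
          finally show "real m * max (real m) (real (Suc b)) powr (th - 1) \<le> (\<Sum>a<m. W b a)" .
        qed (use C0 in auto)
        finally show "(\<Sum>a<m. H a) \<le> (\<Sum>a<m. C * real (Suc b) * W b a)"
          unfolding S_def sum_distrib_left .
      qed auto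
      also have "\<dots> = real (Suc b) * (C * (\<Sum>a<card F. W b a * f (e a)))"
        unfolding sum_distrib_left by (intro sum.cong) auto
      finally show ?thesis by (subst (asm) mult_le_cancel_left_pos) auto
    qed
    have "lp_le x {..<card F} (\<lambda>a. f (e a)) 1"
      using f im(1) lp_le_reindex[OF inj(1)] by metis
    then have "lp_le y {..<card G} (\<lambda>b. \<Sum>a<card F. W b a * f (e a)) C2"
      by (intro C2) (use f0 in auto)
    then have "lp_le y {..<card G} (\<lambda>b. C * (\<Sum>a<card F. W b a * f (e a))) (C * C2)"
      by (rule lp_le_scale) (use f0 C0 C2_0 in \<open>auto simp: W_def intro!: sum_nonneg\<close>)
    then have "lp_le y {..<card G} (\<lambda>b. g (h b)) (C * C2)"
      by (rule lp_le_mono) (use assms main g0 in auto)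
    then have "lp_le y G g (C * C2)"
      using im(2) lp_le_reindex[OF inj(2)] by metis
    then show "lp_le y G (\<lambda>k. \<Sum>j\<in>F. K k j * f j) (C * C2)" unfolding g_def .
  qed (use C0 C2_0 in auto)
  then show ?thesis unfolding K_def .
qed

section \<open>Sufficient conditions\<close>

context group_growth
begin

lemma comparable_powr:
  assumes "J k \<le> 2 * J j" "J j \<le> 2 * J k"
  shows "J j powr b \<le> 2 powr \<bar>b\<bar> * J k powr b"
proof (cases "0 \<le> b")
  case True
  then have "J j powr b \<le> (2 * J k) powr b" using assms J_pos[of j] by (intro powr_mono2) auto
  then show ?thesis using J_pos[of k] True by (simp add: powr_mult)
next
  case False
  then have "J j powr b \<le> (J k / 2) powr b" using assms J_pos[of k] by (intro powr_mono2') auto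
  then show ?thesis using J_pos[of k] False by (simp add: powr_divide powr_minus_divide)
qed

text \<open>Passing to a smaller exponent 1/y < 1/x costs a decaying weight: apply Hoelder to the
  powers u^(1/y) with reciprocal exponents x / y and 1 - x / y. The condition on \<open>w\<close>
  makes the weight summable.\<close>

lemma lp_le_embedding:
  assumes xy: "0 \<le> x" "x < y" and w: "w < - d * (y - x)"
  shows "\<exists>C\<ge>0. \<forall>G u D. finite G \<longrightarrow> 0 \<le> D \<longrightarrow> (\<forall>k. 0 \<le> u k) \<longrightarrow> lp_le x G u D
    \<longrightarrow> lp_le y G (\<lambda>k. J k powr w * u k) (C * D)"
proof -
  have y: "0 < y" using xy by simp
  have "w / y + d * (1 - x / y) = (w + d * (y - x)) / y" using y by (simp add: field_simps)
  then have "w / y + d * (1 - x / y) < 0" using w y by (simp add: divide_neg_pos)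
  moreover have "0 \<le> 1 - x / y" using xy y by simp
  ultimately obtain C where C0: "0 \<le> C" and C: "\<And>R S. \<lbrakk>0 < R; finite S; S \<subseteq> {i. R \<le> J i}\<rbrakk>
      \<Longrightarrow> lp_le (1 - x / y) S (\<lambda>i. J i powr (w / y)) (C * R powr (w / y + d * (1 - x / y)))"
    using lp_le_high by blast
  have "lp_le y G (\<lambda>k. J k powr w * u k) (C powr y * D)"
    if fin: "finite G" and D: "0 \<le> D" and u: "\<And>k. 0 \<le> u k" and le: "lp_le x G u D" for G u D
  proof -
    have 1: "lp_le (1 - x / y) G (\<lambda>i. J i powr (w / y)) C"
      using C[of 1 G] fin J_ge_1 by auto
    have 2: "lp_le (x / y) G (\<lambda>k. u k powr (1 / y)) (D powr (1 / y))"
      using le u y unfolding lp_le_def by (auto simp: powr_powr intro!: powr_mono2)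
    have "(\<Sum>k\<in>G. u k powr (1 / y) * J k powr (w / y)) \<le> D powr (1 / y) * C"
      by (rule lp_le_Holder[OF 2 1]) (use xy y C0 fin in auto)
    then show ?thesis using y u C0 unfolding lp_le_def by (simp add: powr_mult powr_powr mult.commute)
  qed
  then show ?thesis by (intro exI[of _ "C powr y"]) auto
qed

lemma lp_bounded_embedding:
  fixes K :: "'a \<Rightarrow> 'b \<Rightarrow> real"
  assumes K: "lp_bounded x x K" and K0: "\<And>k j. 0 \<le> K k j" and xy: "0 \<le> x" "x < y" and w: "w < - d * (y - x)"
  shows "lp_bounded x y (\<lambda>k j. J k powr w * K k j)"
proof -
  obtain C where C0: "0 \<le> C" and C: "\<And>G u D. \<lbrakk>finite G; 0 \<le> D; \<And>k. 0 \<le> u k; lp_le x G u D\<rbrakk>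
    \<Longrightarrow> lp_le y G (\<lambda>k. J k powr w * u k) (C * D)"
    using lp_le_embedding[OF xy w] by blast
  obtain E where E0: "0 \<le> E" and E: "\<And>F G f. \<lbrakk>finite F; finite G; \<And>j. 0 \<le> f j; lp_le x F f 1\<rbrakk>
    \<Longrightarrow> lp_le x G (\<lambda>k. \<Sum>j\<in>F. K k j * f j) E"
    using K by (rule lp_boundedE) blast
  show ?thesis
  proof (rule lp_boundedI[of "C * E"])
    fix F :: "'b set" and G :: "'a set" and f :: "'b \<Rightarrow> real" assume *: "finite F" "finite G" "\<And>j. 0 \<le> f j" "lp_le x F f 1"
    have "lp_le y G (\<lambda>k. J k powr w * (\<Sum>j\<in>F. K k j * f j)) (C * E)"
      using * E0 K0 by (intro C E) (auto intro: sum_nonneg)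
    then show "lp_le y G (\<lambda>k. \<Sum>j\<in>F. J k powr w * K k j * f j) (C * E)"
      by (simp add: sum_distrib_left mult.assoc)
  qed (use C0 E0 in auto)
qed

text \<open>A rank-one kernel: the output is the sum of \<open>f\<close>, controlled by its l^1
  norm, times a weight of finite norm.\<close>

lemma lp_bounded_weight:
  assumes "0 \<le> y" "y \<le> 1" "u < - d * y"
  shows "lp_bounded 1 y (\<lambda>k j. J k powr u)"
proof -
  have "u + d * y < 0" using assms by simp
  then obtain C where C0: "0 \<le> C" and C: "\<And>R S. \<lbrakk>0 < R; finite S; S \<subseteq> {i. R \<le> J i}\<rbrakk>
      \<Longrightarrow> lp_le y S (\<lambda>i. J i powr u) (C * R powr (u + d * y))"
    using lp_le_high[OF assms(1)] by blast
  have "lp_bounded 1 y (\<lambda>k j. 1 * J k powr u)"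
  proof (rule lp_bounded_Schur[where M = "\<lambda>_. 1" and C = C])
    show "lp_le y G (\<lambda>k. 1 * J k powr u) C" if "finite G" for G
      using C[of 1 G] that J_ge_1 by auto
  qed (use assms C0 in \<open>auto simp: lp_le_def\<close>)
  then show ?thesis by simp
qed

lemma lp_bounded_weight':
  assumes "0 \<le> x" "x \<le> 1" "v < - d * (1 - x)"
  shows "lp_bounded x 0 (\<lambda>k j. J j powr v)"
proof -
  have "lp_bounded 1 (1 - x) (\<lambda>k j. J k powr v)" using assms by (intro lp_bounded_weight) auto
  then have "lp_bounded (1 - (1 - x)) (1 - 1) (\<lambda>k j. J j powr v)"
    by (rule lp_bounded_dual) (use assms in auto)
  then show ?thesis by simp
qed

text \<open>Unlike the operator itself, this kernel has a (harmless) nonzero diagonal.\<close>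

definition wker :: "real \<Rightarrow> real \<Rightarrow> real \<Rightarrow> 'a \<Rightarrow> 'a \<Rightarrow> real" where
  "wker lam s t k j = J k powr s * J (k - j) powr (lam - d) * J j powr (- t)"

lemma wker_nonneg: "0 \<le> wker lam s t k j"
  unfolding wker_def by simp

text \<open>If J(j) > 2 J(k), the triangle inequality gives J(k - j) >= J(j) / 2, so the middle
  factor becomes a power of J(j); symmetrically with k and j exchanged. The three regions may
  overlap, which only increases the majorant.\<close>

lemma lp_bounded_regions:
  assumes lam: "lam < d" and y: "0 \<le> y" "y \<le> 1"
    and U: "lp_bounded x y (\<lambda>k j. if J k \<le> J j then J k powr s * J j powr (lam - d - t) else 0)"
    and L: "lp_bounded x y (\<lambda>k j. if J j \<le> J k then J k powr (s + lam - d) * J j powr (- t) else 0)"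
    and D: "lp_bounded x y (\<lambda>k j. if J k \<le> 2 * J j \<and> J j \<le> 2 * J k then wker lam s t k j else 0)"
  shows "lp_bounded x y (wker lam s t)"
proof -
  define c' where "c' = 2 powr (d - lam)"
  have c': "1 \<le> c'" using lam unfolding c'_def by (intro ge_one_powr_ge_zero) auto
  have half: "J (k - j) powr (lam - d) \<le> c' * J i powr (lam - d)" if "J i \<le> 2 * J (k - j)" for i j k
  proof -
    have "J (k - j) powr (lam - d) \<le> (J i / 2) powr (lam - d)"
      using that lam J_pos[of i] by (intro powr_mono2') auto
    also have "\<dots> = c' * J i powr (lam - d)"
      using J_pos[of i] unfolding c'_def by (simp add: powr_divide powr_diff)
    finally show ?thesis .
  qed
  have "lp_bounded x y (\<lambda>k j. (if J k \<le> J j then J k powr s * J j powr (lam - d - t) else 0)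
    + (if J j \<le> J k then J k powr (s + lam - d) * J j powr (- t) else 0)
    + (if J k \<le> 2 * J j \<and> J j \<le> 2 * J k then wker lam s t k j else 0))" (is "lp_bounded x y (\<lambda>k j. ?U k j + ?L k j + ?D k j)")
    by (intro lp_bounded_add U L D) (use y wker_nonneg in auto)
  then show ?thesis
  proof (rule lp_bounded_mono[where c = c'])
    fix k j
    have nn: "0 \<le> ?U k j" "0 \<le> ?L k j" "0 \<le> ?D k j" using wker_nonneg by auto
    consider "2 * J k < J j" | "2 * J j < J k" | "J k \<le> 2 * J j \<and> J j \<le> 2 * J k" by linarith
    then show "wker lam s t k j \<le> c' * (?U k j + ?L k j + ?D k j)"
    proof cases
      case 1
      then have "J j \<le> 2 * J (k - j)" using J_le_add_diff[of j k] J_diff_commute[of j k] by simp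
      then have "wker lam s t k j \<le> J k powr s * (c' * J j powr (lam - d)) * J j powr (- t)"
        unfolding wker_def by (intro mult_right_mono mult_left_mono half) auto
      also have "\<dots> = c' * (J k powr s * (J j powr (lam - d) * J j powr (- t)))" by simp
      also have "\<dots> = c' * ?U k j" using 1 J_pos[of k] by (simp flip: powr_add)
      also have "\<dots> \<le> c' * (?U k j + ?L k j + ?D k j)" using nn c' by (intro mult_left_mono) auto
      finally show ?thesis .
    next
      case 2
      then have "J k \<le> 2 * J (k - j)" using J_le_add_diff[of k j] by simp
      then have "wker lam s t k j \<le> J k powr s * (c' * J k powr (lam - d)) * J j powr (- t)"
        unfolding wker_def by (intro mult_right_mono mult_left_mono half) auto
      also have "\<dots> = c' * ((J k powr s * J k powr (lam - d)) * J j powr (- t))" by simp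
      also have "\<dots> = c' * ?L k j" using 2 J_pos[of j] by (simp add: add_diff_eq flip: powr_add)
      also have "\<dots> \<le> c' * (?U k j + ?L k j + ?D k j)" using nn c' by (intro mult_left_mono) auto
      finally show ?thesis .
    next
      case 3
      then have "wker lam s t k j = 1 * ?D k j" by simp
      also have "\<dots> \<le> c' * ?D k j" using nn c' by (intro mult_right_mono) auto
      also have "\<dots> \<le> c' * (?U k j + ?L k j + ?D k j)" using nn c' by (intro mult_left_mono) auto
      finally show ?thesis .
    qed
  qed (use c' y wker_nonneg in auto)
qed

section \<open>The region of comparable weights\<close>

lemma wker_comparable:
  assumes "J k \<le> 2 * J j" "J j \<le> 2 * J k"
  shows "wker lam s t k j \<le> 2 powr \<bar>t\<bar> * (J k powr (s - t) * J (k - j) powr (lam - d))"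
proof -
  have "wker lam s t k j \<le> J k powr s * J (k - j) powr (lam - d) * (2 powr \<bar>- t\<bar> * J k powr (- t))"
    unfolding wker_def by (intro mult_left_mono comparable_powr assms) auto
  also have "\<dots> = 2 powr \<bar>t\<bar> * ((J k powr s * J k powr (- t)) * J (k - j) powr (lam - d))" by simp
  finally show ?thesis by (simp flip: powr_add)
qed

text \<open>Since s <= t and J(k - j) <= 3 J(k), the collapsed weight J(k)^(s - t) can be moved onto
  J(k - j). The result is a convolution kernel with more than critical decay.\<close>

lemma lp_bounded_diag_strict:
  assumes xy: "0 \<le> y" "y \<le> x" "x \<le> 1" and "s \<le> t" "lam + d * y + s < d * x + t"
  shows "lp_bounded x y (\<lambda>k j. if J k \<le> 2 * J j \<and> J j \<le> 2 * J k then wker lam s t k j else 0)"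
proof -
  have "lp_bounded x y (\<lambda>k j. J (k - j) powr (lam - d + s - t))"
    by (rule lp_bounded_convolution[OF xy]) (use assms in \<open>simp add: algebra_simps\<close>)
  then show ?thesis
  proof (rule lp_bounded_mono[where c = "2 powr \<bar>t\<bar> * 3 powr (t - s)"])
    fix k j
    show "(if J k \<le> 2 * J j \<and> J j \<le> 2 * J k then wker lam s t k j else 0)
      \<le> 2 powr \<bar>t\<bar> * 3 powr (t - s) * J (k - j) powr (lam - d + s - t)"
    proof (cases "J k \<le> 2 * J j \<and> J j \<le> 2 * J k")
      case True
      have "J (k - j) \<le> 3 * J k" using J_diff_le[of k j] True by simp
      then have "J k powr (s - t) \<le> (J (k - j) / 3) powr (s - t)"
        using assms J_pos[of "k - j"] by (intro powr_mono2') auto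
      also have "\<dots> = 3 powr (t - s) * J (k - j) powr (s - t)"
        using J_pos[of "k - j"] by (simp add: powr_divide powr_diff)
      finally have "2 powr \<bar>t\<bar> * (J k powr (s - t) * J (k - j) powr (lam - d))
        \<le> 2 powr \<bar>t\<bar> * ((3 powr (t - s) * J (k - j) powr (s - t)) * J (k - j) powr (lam - d))"
        by (intro mult_left_mono mult_right_mono) auto
      also have "\<dots> = 2 powr \<bar>t\<bar> * 3 powr (t - s) * (J (k - j) powr (s - t) * J (k - j) powr (lam - d))" by simp
      also have "J (k - j) powr (s - t) * J (k - j) powr (lam - d) = J (k - j) powr (lam - d + s - t)"
        by (simp add: algebra_simps flip: powr_add)
      finally have "wker lam s t k j \<le> 2 powr \<bar>t\<bar> * 3 powr (t - s) * J (k - j) powr (lam - d + s - t)"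
        using True by (intro order.trans[OF wker_comparable]) auto
      then show ?thesis using True by simp
    next
      case False
      then show ?thesis by (subst if_not_P) auto
    qed
  qed (use xy wker_nonneg in auto)
qed

text \<open>For s < t the leftover weight J(k)^(-(t - s)) compensates the critical decay. For s = t
  nothing is left over and lam / d = x - y is the Hardy--Littlewood--Sobolev relation, with its end
  points excluded.\<close>

lemma lp_bounded_diag_critical:
  assumes xy: "0 \<le> y" "y \<le> x" "x \<le> 1" and lam: "0 < lam" and st: "s \<le> t" "lam + d * y + s = d * x + t"
    and ends: "s = t \<Longrightarrow> 0 < y \<and> x < 1"
  shows "lp_bounded x y (\<lambda>k j. if J k \<le> 2 * J j \<and> J j \<le> 2 * J k then wker lam s t k j else 0)"
proof (cases "s = t")
  case False
  have "lp_bounded x y (\<lambda>k j. if J k \<le> 2 * J j \<and> J j \<le> 2 * J k then J k powr (- (t - s)) * J (k - j) powr (- (d - lam)) else 0)"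
    by (rule lp_bounded_diagonal[OF xy]) (use st False in \<open>auto simp: algebra_simps\<close>)
  then show ?thesis
    by (rule lp_bounded_mono[where c = "2 powr \<bar>t\<bar>"])
      (use xy wker_nonneg wker_comparable[of _ _ lam s t] in auto)
next
  case True
  have th: "lam / d = x - y" using st True d_pos by (simp add: field_simps)
  then have "0 < x - y" using lam d_pos by (metis divide_pos_pos)
  then have "lp_bounded x y (\<lambda>k j. J (k - j) powr (d * (lam / d - 1)))"
    using ends[OF True] th by (intro lp_bounded_HLS) auto
  also have "d * (lam / d - 1) = lam - d" using d_pos by (simp add: field_simps)
  finally have conv: "lp_bounded x y (\<lambda>k j. J (k - j) powr (lam - d))" .
  have "wker lam s t k j \<le> 2 powr \<bar>t\<bar> * J (k - j) powr (lam - d)" if "J k \<le> 2 * J j" "J j \<le> 2 * J k" for k j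
    using wker_comparable[OF that, of lam s t] J_pos[of k] True by simp
  with conv show ?thesis
    by (elim lp_bounded_mono[where c = "2 powr \<bar>t\<bar>"]) (use xy wker_nonneg in auto)
qed

section \<open>The sufficient conditions, case by case\<close>

lemma lp_bounded_subcritical:
  assumes lam: "0 < lam" "lam < d" and xy: "0 \<le> y" "y \<le> x" "x \<le> 1"
    and st: "s \<le> t" "lam < d * x + t" "lam + d * y + s < d * x + t" "lam + d * y + s \<le> d"
    and ends: "lam + d * y + s = d \<Longrightarrow> y = 0"
  shows "lp_bounded x y (wker lam s t)"
proof (rule lp_bounded_regions)
  show "lp_bounded x y (\<lambda>k j. if J k \<le> J j then J k powr s * J j powr (lam - d - t) else 0)"
    by (rule lp_bounded_upper[OF xy]) (use st in \<open>auto simp: algebra_simps\<close>)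
  show "lp_bounded x y (\<lambda>k j. if J j \<le> J k then J k powr (s + lam - d) * J j powr (- t) else 0)"
  proof (cases "lam + d * y + s = d")
    case False
    then show ?thesis
      by (intro lp_bounded_lower[OF xy]) (use st in \<open>auto simp: algebra_simps\<close>)
  next
    \<comment> \<open>At this end point the power of J(k) in the lower region disappears, leaving a
      linear functional of \<open>f\<close> that is bounded by Hoelder.\<close>
    case True
    then have y: "y = 0" "s + lam - d = 0" using ends by auto
    have "lp_bounded x 0 (\<lambda>k j. J j powr (- t))"
      by (rule lp_bounded_weight') (use xy st y in \<open>auto simp: algebra_simps\<close>)
    then show ?thesis unfolding y
      by (rule lp_bounded_mono[where c = 1]) auto
  qed
  show "lp_bounded x y (\<lambda>k j. if J k \<le> 2 * J j \<and> J j \<le> 2 * J k then wker lam s t k j else 0)"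
    by (rule lp_bounded_diag_strict[OF xy]) (use st in auto)
qed (use lam xy in auto)

text \<open>With t = lam - d the power of J(j) in the upper region vanishes, so for l^1 input that
  region is a pure weight in k. The other two regions are strictly subcritical.\<close>

lemma lp_bounded_endpoint:
  assumes lam: "0 < lam" "lam < d" and y: "0 \<le> y" "y \<le> 1" and st: "s \<le> t" "t = lam - d" "d * y + s < 0"
  shows "lp_bounded 1 y (wker lam s t)"
proof (rule lp_bounded_regions)
  have "lp_bounded 1 y (\<lambda>k j. J k powr s)"
    by (rule lp_bounded_weight) (use y st in auto)
  then show "lp_bounded 1 y (\<lambda>k j. if J k \<le> J j then J k powr s * J j powr (lam - d - t) else 0)"
    by (rule lp_bounded_mono[where c = 1]) (use y st in auto)
  show "lp_bounded 1 y (\<lambda>k j. if J j \<le> J k then J k powr (s + lam - d) * J j powr (- t) else 0)"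
    by (rule lp_bounded_lower) (use y st lam in \<open>auto simp: algebra_simps\<close>)
  show "lp_bounded 1 y (\<lambda>k j. if J k \<le> 2 * J j \<and> J j \<le> 2 * J k then wker lam s t k j else 0)"
    by (rule lp_bounded_diag_strict) (use y st lam in auto)
qed (use lam y in auto)

lemma lp_bounded_critical:
  assumes lam: "0 < lam" "lam < d" and xy: "0 \<le> y" "y \<le> x" "x \<le> 1"
    and st: "s \<le> t" "lam + d * y + s = d * x + t" "0 < d * y + s" "d * x + t < d"
    and ends: "s = t \<Longrightarrow> 0 < y \<and> x < 1"
  shows "lp_bounded x y (wker lam s t)"
proof (rule lp_bounded_regions)
  show "lp_bounded x y (\<lambda>k j. if J k \<le> J j then J k powr s * J j powr (lam - d - t) else 0)"
    by (rule lp_bounded_upper[OF xy]) (use st in \<open>auto simp: algebra_simps\<close>)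
  show "lp_bounded x y (\<lambda>k j. if J j \<le> J k then J k powr (s + lam - d) * J j powr (- t) else 0)"
    by (rule lp_bounded_lower[OF xy]) (use st in \<open>auto simp: algebra_simps\<close>)
  show "lp_bounded x y (\<lambda>k j. if J k \<le> 2 * J j \<and> J j \<le> 2 * J k then wker lam s t k j else 0)"
    by (rule lp_bounded_diag_critical[OF xy lam(1) st(1,2) ends])
qed (use lam xy in auto)

lemma lp_bounded_wker:
  assumes lam: "0 < lam" "lam < d" and xy: "0 \<le> x" "x \<le> 1" "0 \<le> y" "y \<le> 1" and st: "s \<le> t"
    and cond: "lam + max (d * y + s) 0 < max (d * x + t) 0 \<and> lam + d * y + s \<le> d \<and> (lam + d * y + s = d \<longrightarrow> y = 0)
      \<or> x = 1 \<and> t = lam - d \<and> d * y + s < 0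
      \<or> lam + d * y + s = d * x + t \<and> y \<le> x \<and> 0 < d * y + s \<and> d * x + t < d \<and> (s = t \<longrightarrow> 0 < y \<and> x < 1)"
  shows "lp_bounded x y (wker lam s t)"
  using cond
proof (elim disjE)
  assume C1: "lam + max (d * y + s) 0 < max (d * x + t) 0 \<and> lam + d * y + s \<le> d \<and> (lam + d * y + s = d \<longrightarrow> y = 0)"
  \<comment> \<open>The left-hand side is positive because lam > 0, so the maximum on the right must
    be d x + t itself.\<close>
  then have le: "lam < d * x + t" "lam + d * y + s < d * x + t" using lam by (auto simp: max_def split: if_splits)
  show ?thesis
  proof (cases "y \<le> x")
    case True
    then show ?thesis using C1 le lam xy st by (intro lp_bounded_subcritical) auto
  next
    case False
    then have yx: "x < y" by simp
    \<comment> \<open>Equality would force y = 0, contrary to 0 <= x < y.\<close>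
    then have "lam + d * y + s < d" using C1 xy by (auto simp: order.strict_iff_order)
    \<comment> \<open>Half of the smaller of the two strict margins, so that both inequalities
      survive a shift by \<open>e\<close>.\<close>
    define e where "e = min (d * x + t - (lam + d * y + s)) (d - (lam + d * y + s)) / 2"
    have e: "0 < e" "e < d * x + t - (lam + d * y + s)" "e < d - (lam + d * y + s)"
      using le \<open>lam + d * y + s < d\<close> unfolding e_def by (auto simp: min_def)
    \<comment> \<open>The larger weight \<open>r\<close> keeps the kernel subcritical from l^(1/x)
      to itself, while s - r = -d (y - x) - e is just enough decay for the embedding into
      l^(1/y).\<close>
    define r where "r = s + d * (y - x) + e"
    have r: "d * x + r = d * y + s + e" unfolding r_def by (simp add: algebra_simps)
    have "lp_bounded x x (wker lam r t)"
      using e r le lam xy by (intro lp_bounded_subcritical) auto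
    then have "lp_bounded x y (\<lambda>k j. J k powr (s - r) * wker lam r t k j)"
      by (rule lp_bounded_embedding) (use wker_nonneg xy yx e in \<open>auto simp: r_def algebra_simps\<close>)
    also have "(\<lambda>k j. J k powr (s - r) * wker lam r t k j) = wker lam s t"
    proof (intro ext)
      fix k j
      have "J k powr (s - r) * J k powr r = J k powr s" by (simp flip: powr_add)
      then show "J k powr (s - r) * wker lam r t k j = wker lam s t k j"
        unfolding wker_def by (metis mult.assoc)
    qed
    finally show ?thesis .
  qed
next
  assume "x = 1 \<and> t = lam - d \<and> d * y + s < 0"
  then show ?thesis using lp_bounded_endpoint[of lam y s t] lam xy st by simp
next
  assume "lam + d * y + s = d * x + t \<and> y \<le> x \<and> 0 < d * y + s \<and> d * x + t < d \<and> (s = t \<longrightarrow> 0 < y \<and> x < 1)"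
  then show ?thesis using lam xy st by (intro lp_bounded_critical) auto
qed

end

section \<open>The integer lattice\<close>

lemma lat_norm_L2_set: "lat_norm k = L2_set (\<lambda>i. real_of_int (k $ i)) UNIV"
  unfolding lat_norm_def L2_set_def ..

lemma lat_norm_nonneg: "0 \<le> lat_norm k"
  unfolding lat_norm_L2_set by (rule L2_set_nonneg)

lemma lat_norm_zero: "lat_norm 0 = 0"
  unfolding lat_norm_def by simp

lemma lat_norm_minus: "lat_norm (- k) = lat_norm k"
  unfolding lat_norm_def by simp

lemma lat_norm_add: "lat_norm (i + j) \<le> lat_norm i + lat_norm j"
  using L2_set_triangle_ineq[of "\<lambda>l. real_of_int (i $ l)" "\<lambda>l. real_of_int (j $ l)" UNIV]
  unfolding lat_norm_L2_set by simp

lemma abs_component_le_lat_norm: "\<bar>real_of_int (k $ i)\<bar> \<le> lat_norm k"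
  using member_le_L2_set[of UNIV i "\<lambda>i. \<bar>real_of_int (k $ i)\<bar>"] unfolding lat_norm_def L2_set_def by simp

lemma lat_norm_ge_1:
  assumes "k \<noteq> 0"
  shows "1 \<le> lat_norm k"
proof -
  obtain i where "k $ i \<noteq> 0" using assms by (auto simp: vec_eq_iff)
  then have "1 \<le> \<bar>real_of_int (k $ i)\<bar>" by linarith
  then show ?thesis using abs_component_le_lat_norm[of k i] by linarith
qed

lemma jbr_ge_1: "1 \<le> jbr k"
  unfolding jbr_def by simp

lemma lat_norm_le_jbr: "lat_norm k \<le> jbr k"
  unfolding jbr_def by (rule real_le_rsqrt) simp

lemma jbr_le_lat_norm:
  assumes "k \<noteq> 0"
  shows "jbr k \<le> 2 * lat_norm k"
proof -
  have "1 \<le> (lat_norm k)\<^sup>2" using lat_norm_ge_1[OF assms] by simp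
  then have "1 + (lat_norm k)\<^sup>2 \<le> (2 * lat_norm k)\<^sup>2" by (simp add: power_mult_distrib)
  then show ?thesis unfolding jbr_def using lat_norm_nonneg[of k] by (intro real_le_lsqrt) auto
qed

lemma jbr_minus: "jbr (- k) = jbr k"
  unfolding jbr_def by (simp add: lat_norm_minus)

lemma jbr_add: "jbr (i + j) \<le> jbr i + jbr j"
proof -
  have "jbr (i + j) \<le> sqrt ((1 + 0)\<^sup>2 + (lat_norm i + lat_norm j)\<^sup>2)"
    unfolding jbr_def using lat_norm_add[of i j] lat_norm_nonneg[of "i + j"] by (simp add: power_mono)
  also have "\<dots> \<le> sqrt (1\<^sup>2 + (lat_norm i)\<^sup>2) + sqrt (0\<^sup>2 + (lat_norm j)\<^sup>2)"
    by (rule real_sqrt_sum_squares_triangle_ineq)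
  also have "\<dots> \<le> jbr i + jbr j"
    using lat_norm_le_jbr[of j] lat_norm_nonneg[of j] unfolding jbr_def by simp
  finally show ?thesis .
qed

lemma lattice_box:
  fixes A :: "int set"
  assumes "finite A"
  shows "finite {k :: int ^ 'n::finite. \<forall>i. k $ i \<in> A}" "card {k :: int ^ 'n::finite. \<forall>i. k $ i \<in> A} = card A ^ CARD('n)"
proof -
  have eq: "{k :: int ^ 'n. \<forall>i. k $ i \<in> A} = vec_lambda ` (Pi\<^sub>E UNIV (\<lambda>_. A))"
  proof (intro set_eqI iffI)
    fix k :: "int ^ 'n" assume "k \<in> {k. \<forall>i. k $ i \<in> A}"
    then show "k \<in> vec_lambda ` (Pi\<^sub>E UNIV (\<lambda>_. A))"
      by (intro image_eqI[of _ _ "vec_nth k"]) auto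
  qed auto
  have inj: "inj_on (vec_lambda :: ('n \<Rightarrow> int) \<Rightarrow> int ^ 'n) X" for X
    by (auto simp: inj_on_def vec_lambda_inject)
  show "finite {k :: int ^ 'n. \<forall>i. k $ i \<in> A}"
    unfolding eq using assms by (intro finite_imageI finite_PiE) auto
  show "card {k :: int ^ 'n. \<forall>i. k $ i \<in> A} = card A ^ CARD('n)"
    unfolding eq by (subst card_image[OF inj]) (simp add: card_PiE)
qed

interpretation lattice: group_growth "jbr :: int ^ 'n::finite \<Rightarrow> real" "real CARD('n)" "3 ^ CARD('n)"
proof
  have sub: "{k :: int ^ 'n. jbr k \<le> R} \<subseteq> {k. \<forall>i. k $ i \<in> {- \<lfloor>R\<rfloor>..\<lfloor>R\<rfloor>}}" for R
  proof (clarify)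
    fix k :: "int ^ 'n" and i assume "jbr k \<le> R"
    then have "\<bar>real_of_int (k $ i)\<bar> \<le> R"
      using abs_component_le_lat_norm[of k i] lat_norm_le_jbr[of k] by linarith
    then have "k $ i \<le> \<lfloor>R\<rfloor>" "- (k $ i) \<le> \<lfloor>R\<rfloor>" unfolding le_floor_iff by auto
    then show "k $ i \<in> {- \<lfloor>R\<rfloor>..\<lfloor>R\<rfloor>}" by simp
  qed
  show "finite {k :: int ^ 'n. jbr k \<le> R}" for R
    by (rule finite_subset[OF sub]) (rule lattice_box, simp)
  show "real (card {k :: int ^ 'n. jbr k \<le> R}) \<le> 3 ^ CARD('n) * R powr real CARD('n)" if "1 \<le> R" for R
  proof -
    have "card {k :: int ^ 'n. jbr k \<le> R} \<le> card {k :: int ^ 'n. \<forall>i. k $ i \<in> {- \<lfloor>R\<rfloor>..\<lfloor>R\<rfloor>}}"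
      by (rule card_mono[OF _ sub]) (rule lattice_box, simp)
    also have "\<dots> = nat (2 * \<lfloor>R\<rfloor> + 1) ^ CARD('n)" by (subst lattice_box) auto
    finally have "real (card {k :: int ^ 'n. jbr k \<le> R}) \<le> real (nat (2 * \<lfloor>R\<rfloor> + 1) ^ CARD('n))"
      by (rule of_nat_mono)
    also have "\<dots> = (real (nat (2 * \<lfloor>R\<rfloor> + 1))) ^ CARD('n)" by simp
    also have "\<dots> \<le> (3 * R) ^ CARD('n)"
    proof (intro power_mono)
      have "real_of_int \<lfloor>R\<rfloor> \<le> R" "0 \<le> \<lfloor>R\<rfloor>" using that by auto
      then have "real (nat (2 * \<lfloor>R\<rfloor> + 1)) \<le> 2 * R + 1" by simp
      then show "real (nat (2 * \<lfloor>R\<rfloor> + 1)) \<le> 3 * R" using that by linarith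
    qed simp
    also have "\<dots> = 3 ^ CARD('n) * R powr real CARD('n)"
      using that by (simp add: power_mult_distrib powr_realpow)
    finally show ?thesis .
  qed
qed (auto simp: jbr_ge_1 jbr_minus jbr_add)

text \<open>The diagonal vanishes automatically because lat_norm 0 = 0 and 0 powr a = 0.\<close>

definition lker :: "real \<Rightarrow> real \<Rightarrow> real \<Rightarrow> int ^ ('n::finite) \<Rightarrow> int ^ 'n \<Rightarrow> real" where
  "lker lam s t k j = jbr k powr s * lat_norm (k - j) powr (lam - real CARD('n)) * jbr j powr (- t)"

lemma lker_nonneg: "0 \<le> lker lam s t k j"
  unfolding lker_def by simp

text \<open>Off the diagonal \<open>lat_norm\<close> is at least half of \<open>jbr\<close>, and on
  the diagonal \<open>lker\<close> is 0; so \<open>wker\<close> dominates it up to a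
  constant.\<close>

lemma lp_bounded_lker:
  assumes "lp_bounded x y (lattice.wker lam s t :: int ^ 'n::finite \<Rightarrow> int ^ 'n \<Rightarrow> real)" "0 \<le> y" "lam < real CARD('n)"
  shows "lp_bounded x y (lker lam s t :: int ^ 'n \<Rightarrow> int ^ 'n \<Rightarrow> real)"
  using assms(1)
proof (rule lp_bounded_mono[where c = "2 powr (real CARD('n) - lam)"])
  fix k j :: "int ^ 'n"
  have "lat_norm (k - j) powr (lam - real CARD('n)) \<le> 2 powr (real CARD('n) - lam) * jbr (k - j) powr (lam - real CARD('n))"
  proof (cases "k = j")
    case False
    then have "lat_norm (k - j) powr (lam - real CARD('n)) \<le> (jbr (k - j) / 2) powr (lam - real CARD('n))"
      using jbr_le_lat_norm[of "k - j"] lattice.J_pos[of "k - j"] assms(3) by (intro powr_mono2') auto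
    also have "\<dots> = 2 powr (real CARD('n) - lam) * jbr (k - j) powr (lam - real CARD('n))"
      using lattice.J_pos[of "k - j"] by (simp add: powr_divide powr_diff)
    finally show ?thesis .
  qed (simp add: lat_norm_zero)
  then have "lker lam s t k j \<le> jbr k powr s * (2 powr (real CARD('n) - lam) * jbr (k - j) powr (lam - real CARD('n))) * jbr j powr (- t)"
    unfolding lker_def by (intro mult_right_mono mult_left_mono) auto
  then show "lker lam s t k j \<le> 2 powr (real CARD('n) - lam) * lattice.wker lam s t k j"
    unfolding lattice.wker_def by (simp add: mult_ac)
qed (use assms lker_nonneg in auto)

section \<open>Exponents, weighted norms and the passage between operator and kernel\<close>

lemma recip_cases:
  assumes "1 \<le> p"
  obtains "p = \<infinity>" "recip p = 0" | r where "p = ereal r" "1 \<le> r" "recip p = 1 / r"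
proof (cases p)
  case (real r)
  then show thesis using assms that(2)[of r] by (simp add: recip_def one_ereal_def)
qed (use assms that in \<open>auto simp: recip_def\<close>)

lemma recip_bounds:
  assumes "1 \<le> p"
  shows "0 \<le> recip p" "recip p \<le> 1"
  using assms by (rule recip_cases; simp)+

lemma recip_eq_1_iff:
  assumes "1 \<le> p"
  shows "recip p = 1 \<longleftrightarrow> p = 1"
  using assms by (rule recip_cases) (auto simp: one_ereal_def)

lemma recip_eq_0_iff:
  assumes "1 \<le> p"
  shows "recip p = 0 \<longleftrightarrow> p = \<infinity>"
  using assms by (rule recip_cases) auto

lemma dual_exp_eq_1_iff:
  assumes "1 \<le> q"
  shows "dual_exp q = 1 \<longleftrightarrow> q = \<infinity>"
  using assms by (rule recip_cases) (auto simp: dual_exp_def one_ereal_def)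

lemma lps_norm_nonneg:
  assumes "in_lps p s (a :: int ^ 'n::finite \<Rightarrow> complex)"
  shows "0 \<le> lps_norm p s a"
proof (cases "p = \<infinity>")
  case True
  have "0 \<le> norm (a 0) * jbr (0 :: int ^ 'n) powr s" by simp
  also have "\<dots> \<le> (SUP k. norm (a k) * jbr k powr s)"
    using assms True unfolding in_lps_def by (intro cSUP_upper) auto
  finally show ?thesis using True unfolding lps_norm_def by simp
qed (simp add: lps_norm_def)

text \<open>Together with \<open>lps_norm_le\<close> this describes the weighted norm by its finite
  sections, treating finite and infinite exponents alike.\<close>

lemma lp_le_lps_norm:
  fixes a :: "int ^ 'n::finite \<Rightarrow> complex"
  assumes p: "1 \<le> p" and a: "in_lps p s a" and fin: "finite F"
  shows "lp_le (recip p) F (\<lambda>k. norm (a k) * jbr k powr s) (lps_norm p s a)"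
  using p
proof (rule recip_cases)
  assume "p = \<infinity>" "recip p = 0"
  then show ?thesis using a unfolding lp_le_def lps_norm_def in_lps_def
    by (auto intro!: cSUP_upper)
next
  fix r assume r: "p = ereal r" "1 \<le> r" "recip p = 1 / r"
  let ?S = "\<Sum>\<^sub>\<infinity>k. norm (a k) powr r * jbr k powr (r * s)"
  have "(\<Sum>k\<in>F. norm (a k) powr r * jbr k powr (r * s)) \<le> ?S"
    using a r fin unfolding in_lps_def by (intro finite_sum_le_infsum) auto
  also have "?S = (?S powr (1 / r)) powr r"
    using r by (simp add: powr_powr infsum_nonneg)
  finally show ?thesis using r unfolding lp_le_def lps_norm_def by (simp add: powr_mult powr_powr mult.commute)
qed

lemma lps_norm_le:
  fixes a :: "int ^ 'n::finite \<Rightarrow> complex"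
  assumes p: "1 \<le> p" and le: "\<And>F. finite F \<Longrightarrow> lp_le (recip p) F (\<lambda>k. norm (a k) * jbr k powr s) D" and D: "0 \<le> D"
  shows "in_lps p s a \<and> lps_norm p s a \<le> D"
  using p
proof (rule recip_cases)
  assume p: "p = \<infinity>" "recip p = 0"
  have "norm (a k) * jbr k powr s \<le> D" for k using le[of "{k}"] p unfolding lp_le_def by simp
  then show ?thesis using p unfolding in_lps_def lps_norm_def by (auto intro!: bdd_aboveI2 cSUP_least)
next
  fix r assume r: "p = ereal r" "1 \<le> r" "recip p = 1 / r"
  let ?f = "\<lambda>k. norm (a k) powr r * jbr k powr (r * s)"
  have b: "sum ?f F \<le> D powr r" if "finite F" for F
    using le[OF that] r unfolding lp_le_def by (simp add: powr_mult powr_powr mult.commute)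
  have sm: "?f summable_on UNIV"
    by (rule nonneg_bdd_above_summable_on) (auto intro!: bdd_aboveI2[of _ _ "D powr r"] b)
  have "infsum ?f UNIV \<le> D powr r" by (rule infsum_le_finite_sums[OF sm b])
  then have "infsum ?f UNIV powr (1 / r) \<le> (D powr r) powr (1 / r)"
    using r by (intro powr_mono2) (auto intro: infsum_nonneg)
  also have "\<dots> = D" using r D by (simp add: powr_powr)
  finally show ?thesis using r sm unfolding in_lps_def lps_norm_def by simp
qed

lemma frac_int_bounded_if_lp_bounded:
  assumes K: "lp_bounded (recip p) (recip q) (lker lam s t :: int ^ 'n::finite \<Rightarrow> int ^ 'n \<Rightarrow> real)"
    and pq: "1 \<le> p" "1 \<le> q"
  shows "frac_int_bounded lam TYPE('n) p t q s"
proof -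
  let ?x = "recip p" and ?y = "recip q" and ?n = "real CARD('n)"
  obtain C where C0: "0 \<le> C" and C: "\<And>F G f D. \<lbrakk>finite F; finite G; \<And>j. 0 \<le> f j; 0 \<le> D; lp_le ?x F f D\<rbrakk>
    \<Longrightarrow> lp_le ?y G (\<lambda>k. \<Sum>j\<in>F. (lker lam s t :: int ^ 'n \<Rightarrow> int ^ 'n \<Rightarrow> real) k j * f j) (C * D)"
    using lp_bounded_scaledE[OF K recip_bounds(1)[OF pq(1)] recip_bounds(1)[OF pq(2)] lker_nonneg] by blast
  show ?thesis unfolding frac_int_bounded_def
  proof (intro exI[of _ C] allI impI)
    fix f :: "int ^ 'n \<Rightarrow> complex"
    assume f: "in_lps p t f"
    define D where "D = lps_norm p t f"
    have D: "0 \<le> D" unfolding D_def by (rule lps_norm_nonneg[OF f])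
    \<comment> \<open>Absolute values of the terms. For j = k the denominator is 0, hence the term
      is 0 by the convention for division, and sums over \<open>UNIV\<close> agree with sums off the
      diagonal.\<close>
    define h where "h = (\<lambda>k j. norm (f j / complex_of_real (lat_norm (k - j) powr (?n - lam))))"
    have h: "h k j = lat_norm (k - j) powr (lam - ?n) * norm (f j)" for k j
      unfolding h_def by (simp add: norm_divide powr_minus_divide[of _ "?n - lam", simplified])
    have lk: "lker lam s t k j * (norm (f j) * jbr j powr t) = jbr k powr s * h k j" for k j
    proof -
      have 1: "jbr j powr (- t) * jbr j powr t = 1" using lattice.J_pos[of j] by (simp flip: powr_add)
      have "lker lam s t k j * (norm (f j) * jbr j powr t) = jbr k powr s * h k j * (jbr j powr (- t) * jbr j powr t)"
        unfolding lker_def h by (simp only: mult_ac)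
      then show ?thesis unfolding 1 by simp
    qed
    have fin: "lp_le ?y G (\<lambda>k. jbr k powr s * (\<Sum>j\<in>F. h k j)) (C * D)" if "finite F" "finite G" for F G
      using C[of F G "\<lambda>j. norm (f j) * jbr j powr t" D] that D lp_le_lps_norm[OF pq(1) f that(1)]
      unfolding D_def lk sum_distrib_left by simp
    have h0: "0 \<le> h k j" for k j unfolding h_def by simp
    \<comment> \<open>A singleton \<open>G\<close> turns the norm bound into a pointwise bound for
      all partial sums, hence absolute convergence at every k.\<close>
    have bd: "(\<Sum>j\<in>F. h k j) \<le> C * D * jbr k powr (- s)" if "finite F" for F k
    proof -
      have "jbr k powr s * (\<Sum>j\<in>F. h k j) \<le> C * D"
        using lp_le_point[OF fin[OF that, of "{k}"], of k] recip_bounds pq C0 D h0 by (simp add: sum_nonneg)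
      then show ?thesis using lattice.J_pos[of k] by (simp add: powr_minus_divide field_simps)
    qed
    have hs: "h k summable_on UNIV" for k
      by (rule nonneg_bdd_above_summable_on) (use h0 bd in \<open>auto intro!: bdd_aboveI2\<close>)
    have hsd: "h k summable_on (UNIV - {k})" for k
      by (rule summable_on_subset_banach[OF hs]) simp
    have sm: "(\<lambda>j. f j / complex_of_real (lat_norm (k - j) powr (?n - lam))) summable_on (UNIV - {k})" for k
      using hsd[of k] unfolding h_def by (rule abs_summable_summable)
    have le: "norm (frac_int lam f k) \<le> infsum (h k) UNIV" for k
    proof -
      have "norm (frac_int lam f k) \<le> infsum (h k) (UNIV - {k})"
        unfolding frac_int_def h_def using hsd[of k] unfolding h_def by (rule norm_infsum_bound)
      also have "\<dots> \<le> infsum (h k) UNIV"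
        by (rule infsum_mono2[OF hsd hs]) (use h0 in auto)
      finally show ?thesis .
    qed
    have "lp_le ?y G (\<lambda>k. norm (frac_int lam f k) * jbr k powr s) (C * D)" if G: "finite G" for G
    proof -
      have "lp_le ?y G (\<lambda>k. jbr k powr s * infsum (h k) UNIV) (C * D)"
      \<comment> \<open>The finite-section bound is uniform in \<open>F\<close>, so \<open>F\<close>
        can exhaust the lattice while \<open>G\<close> stays fixed.\<close>
      proof (rule lp_le_tendsto[where Fl = "finite_subsets_at_top UNIV" and S = "\<lambda>F k. jbr k powr s * (\<Sum>j\<in>F. h k j)"])
        show "((\<lambda>F. jbr k powr s * (\<Sum>j\<in>F. h k j)) \<longlongrightarrow> jbr k powr s * infsum (h k) UNIV) (finite_subsets_at_top UNIV)" for k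
          by (intro tendsto_mult tendsto_const infsum_tendsto hs)
        show "\<forall>\<^sub>F F in finite_subsets_at_top UNIV. lp_le ?y G (\<lambda>k. jbr k powr s * (\<Sum>j\<in>F. h k j)) (C * D)"
          using fin G by (auto intro: eventually_finite_subsets_at_top_weakI)
      qed (use h0 recip_bounds pq in \<open>auto intro!: sum_nonneg mult_nonneg_nonneg\<close>)
      then show ?thesis
      proof (rule lp_le_mono)
        show "norm (frac_int lam f k) * jbr k powr s \<le> jbr k powr s * infsum (h k) UNIV" for k
          using mult_left_mono[OF le[of k], of "jbr k powr s"] by (simp add: mult.commute)
      qed (use recip_bounds pq in auto)
    qed
    then have "in_lps q s (frac_int lam f) \<and> lps_norm q s (frac_int lam f) \<le> C * D"
      using C0 D by (intro lps_norm_le[OF pq(2)]) auto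
    then show "(\<forall>k. (\<lambda>j. f j / complex_of_real (lat_norm (k - j) powr (?n - lam))) summable_on (UNIV - {k}))
        \<and> in_lps q s (frac_int lam f) \<and> lps_norm q s (frac_int lam f) \<le> C * lps_norm p t f"
      using sm unfolding D_def by blast
  qed
qed

lemma lp_bounded_if_frac_int_bounded:
  assumes bd: "frac_int_bounded lam TYPE('n::finite) p t q s" and pq: "1 \<le> p" "1 \<le> q"
  shows "lp_bounded (recip p) (recip q) (lker lam s t :: int ^ 'n \<Rightarrow> int ^ 'n \<Rightarrow> real)"
proof -
  let ?x = "recip p" and ?y = "recip q" and ?n = "real CARD('n)"
  obtain C where C: "\<And>f :: int ^ 'n \<Rightarrow> complex. in_lps p t f \<Longrightarrow>
      in_lps q s (frac_int lam f) \<and> lps_norm q s (frac_int lam f) \<le> C * lps_norm p t f"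
    using bd unfolding frac_int_bounded_def by blast
  show ?thesis
  \<comment> \<open>The constant of the operator bound carries no sign condition, hence the maximum
    with 0.\<close>
  proof (rule lp_boundedI[of "max C 0"])
    fix F G :: "(int ^ 'n) set" and f :: "int ^ 'n \<Rightarrow> real"
    assume fin: "finite F" "finite G" and f0: "\<And>j. 0 \<le> f j" and f: "lp_le ?x F f 1"
    \<comment> \<open>Undoing the weight and extending by 0 gives a finitely supported lattice
      function of norm at most 1, so the operator series reduces to a finite kernel sum.\<close>
    define g where "g = (\<lambda>j. if j \<in> F then complex_of_real (f j * jbr j powr (- t)) else 0)"
    have ng: "norm (g j) * jbr j powr t = (if j \<in> F then f j else 0)" for j
      using f0[of j] lattice.J_pos[of j] unfolding g_def by (simp add: norm_mult flip: powr_add)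
    have g: "in_lps p t g \<and> lps_norm p t g \<le> 1"
    proof (rule lps_norm_le[OF pq(1)])
      fix E :: "(int ^ 'n) set" assume "finite E"
      then show "lp_le ?x E (\<lambda>k. norm (g k) * jbr k powr t) 1"
        unfolding ng by (subst lp_le_filter) (auto intro!: lp_le_subset[OF f] fin)
    qed simp
    have fr: "norm (frac_int lam g k) * jbr k powr s = (\<Sum>j\<in>F. lker lam s t k j * f j)" for k
    proof -
      have "frac_int lam g k = (\<Sum>\<^sub>\<infinity>j\<in>F. g j / complex_of_real (lat_norm (k - j) powr (?n - lam)))"
        unfolding frac_int_def
        by (rule infsum_cong_neutral) (auto simp: g_def lat_norm_zero)
      also have "\<dots> = (\<Sum>j\<in>F. complex_of_real (lat_norm (k - j) powr (lam - ?n) * (f j * jbr j powr (- t))))"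
        using fin by (simp add: g_def powr_minus_divide[of _ "?n - lam", simplified])
      finally have "frac_int lam g k = complex_of_real (\<Sum>j\<in>F. lat_norm (k - j) powr (lam - ?n) * (f j * jbr j powr (- t)))"
        by (simp only: of_real_sum)
      then have "norm (frac_int lam g k) = (\<Sum>j\<in>F. lat_norm (k - j) powr (lam - ?n) * (f j * jbr j powr (- t)))"
        using f0 by (simp only: norm_of_real abs_of_nonneg sum_nonneg mult_nonneg_nonneg powr_ge_zero)
      then show ?thesis unfolding lker_def by (simp add: sum_distrib_left sum_distrib_right mult_ac)
    qed
    have Cg: "in_lps q s (frac_int lam g)" "lps_norm q s (frac_int lam g) \<le> C * lps_norm p t g"
      using C g by auto
    have "lps_norm q s (frac_int lam g) \<le> C * lps_norm p t g" by (rule Cg)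
    also have "\<dots> \<le> max C 0 * 1"
      using g lps_norm_nonneg[of p t g] by (intro mult_mono) auto
    finally have le: "lps_norm q s (frac_int lam g) \<le> max C 0" by simp
    have "lp_le ?y G (\<lambda>k. norm (frac_int lam g k) * jbr k powr s) (lps_norm q s (frac_int lam g))"
      by (rule lp_le_lps_norm[OF pq(2) Cg(1) fin(2)])
    then have "lp_le ?y G (\<lambda>k. norm (frac_int lam g k) * jbr k powr s) (max C 0)"
      by (rule lp_le_weaken) (use recip_bounds pq le lps_norm_nonneg[OF Cg(1)] in auto)
    then show "lp_le ?y G (\<lambda>k. \<Sum>j\<in>F. lker lam s t k j * f j) (max C 0)" unfolding fr .
  qed simp
qed

section \<open>Necessary conditions\<close>

lemma powr_bounded_imp_nonpos:
  fixes a C :: real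
  assumes "\<And>M::nat. N \<le> M \<Longrightarrow> 0 < M \<Longrightarrow> real M powr a \<le> C"
  shows "a \<le> 0"
proof (rule ccontr)
  assume "\<not> a \<le> 0"
  then have a: "0 < a" by simp
  define B where "B = max C 1"
  obtain M :: nat where M: "B powr (1 / a) < real M" using reals_Archimedean2 by blast
  define M' where "M' = max M N"
  have "B powr (1 / a) < real M'" using M unfolding M'_def by linarith
  then have "(B powr (1 / a)) powr a < real M' powr a" using a by (intro powr_less_mono2) auto
  moreover have "B \<ge> 1" unfolding B_def by simp
  ultimately have "B < real M' powr a" using a by (simp add: powr_powr)
  moreover have "0 < M'" using \<open>B powr (1 / a) < real M'\<close> by (metis gr0I of_nat_0 not_less powr_ge_zero)
  then have "real M' powr a \<le> C" using assms[of M'] unfolding M'_def by simp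
  ultimately show False unfolding B_def by simp
qed

lemma two_powr_bounded_imp_nonpos:
  fixes a b C :: real
  assumes "\<And>m::nat. 2 powr (real m * a + b) \<le> C"
  shows "a \<le> 0"
proof (rule ccontr)
  assume "\<not> a \<le> 0"
  then have a: "0 < a" by simp
  have C: "0 < C" using assms[of 0] by (rule less_le_trans[rotated]) simp
  obtain m :: nat where "(log 2 C - b) / a < real m" using reals_Archimedean2 by blast
  then have "log 2 C < real m * a + b" using a by (simp add: field_simps)
  then have "C < 2 powr (real m * a + b)" using C by (simp add: log_less_iff)
  then show False using assms[of m] by simp
qed

section \<open>Dyadic cubes and the reduction to a matrix\<close>

text \<open>Every coordinate lies in the same dyadic interval. All points of a cube thus have size
  comparable to 2^m, and their number is exactly 2^(m n).\<close>

definition cube :: "nat \<Rightarrow> (int ^ 'n::finite) set" where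
  "cube m = {k. \<forall>i. k $ i \<in> {2 ^ m..<2 ^ Suc m}}"

lemma cube_finite_card:
  "finite (cube m :: (int ^ 'n::finite) set)"
  "real (card (cube m :: (int ^ 'n) set)) = (2 ^ m) powr real CARD('n)"
proof -
  show "finite (cube m :: (int ^ 'n::finite) set)" unfolding cube_def by (rule lattice_box) simp
  have "card (cube m :: (int ^ 'n) set) = (2 ^ m) ^ CARD('n)"
    unfolding cube_def by (subst lattice_box) (auto simp: nat_power_eq)
  then show "real (card (cube m :: (int ^ 'n) set)) = (2 ^ m) powr real CARD('n)"
    by (simp add: powr_realpow)
qed

lemma cube_disjoint:
  assumes "k \<in> cube l" "k \<in> cube m"
  shows "l = m"
proof -
  have "\<not> l < m" if "k \<in> cube l" "k \<in> cube m" for l m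
  proof
    assume "l < m"
    then have "(2::int) ^ Suc l \<le> 2 ^ m" by (intro power_increasing) auto
    moreover have "k $ undefined < 2 ^ Suc l" "2 ^ m \<le> k $ undefined"
      using that unfolding cube_def by auto
    ultimately show False by linarith
  qed
  then show ?thesis using assms by (metis linorder_neqE_nat)
qed

text \<open>Meaningful only on the union of the cubes, where disjointness makes the index
  unique.\<close>

definition cube_index :: "int ^ ('n::finite) \<Rightarrow> nat" where
  "cube_index k = (THE m. k \<in> cube m)"

lemma cube_index_eq: "k \<in> cube m \<Longrightarrow> cube_index k = m"
  unfolding cube_index_def using cube_disjoint by (intro the_equality) auto

lemma jbr_cube:
  assumes "(k :: int ^ 'n::finite) \<in> cube m"
  shows "2 ^ m \<le> jbr k" "jbr k \<le> (1 + 2 * real CARD('n)) * 2 ^ m"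
proof -
  have k: "2 ^ m \<le> k $ i" "k $ i < 2 ^ Suc m" for i using assms unfolding cube_def by auto
  have "real_of_int (2 ^ m) \<le> real_of_int (k $ undefined)" using k(1) by (simp only: of_int_le_iff)
  then have "2 ^ m \<le> real_of_int (k $ undefined)" by (simp only: of_int_power of_int_numeral)
  then show "2 ^ m \<le> jbr k"
    using abs_component_le_lat_norm[of k undefined] lat_norm_le_jbr[of k] by linarith
  have "lat_norm k \<le> (\<Sum>i\<in>UNIV. \<bar>real_of_int (k $ i)\<bar>)"
    unfolding lat_norm_L2_set by (rule L2_set_le_sum_abs)
  also have "\<dots> \<le> (\<Sum>i\<in>(UNIV :: 'n set). 2 * 2 ^ m)"
  proof (rule sum_mono)
    fix i
    have "0 \<le> k $ i" using k(1)[of i] by (rule order.trans[rotated]) simp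
    moreover have "real_of_int (k $ i) \<le> real_of_int (2 ^ Suc m)" using k(2)[of i] by (simp only: of_int_le_iff)
    ultimately show "\<bar>real_of_int (k $ i)\<bar> \<le> 2 * 2 ^ m" by simp
  qed
  also have "\<dots> = 2 * real CARD('n) * 2 ^ m" by simp
  finally have "lat_norm k \<le> 2 * real CARD('n) * 2 ^ m" .
  moreover have "jbr k \<le> 1 + lat_norm k"
    unfolding jbr_def using lat_norm_nonneg[of k] by (intro real_le_lsqrt) (auto simp: power2_eq_square algebra_simps)
  moreover have "(1::real) \<le> 2 ^ m" by simp
  ultimately show "jbr k \<le> (1 + 2 * real CARD('n)) * 2 ^ m" unfolding distrib_right by linarith
qed

lemma sum_cubes:
  fixes g :: "int ^ 'n::finite \<Rightarrow> real"
  assumes "finite F"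
  shows "(\<Sum>k\<in>(\<Union>m\<in>F. cube m). g k) = (\<Sum>m\<in>F. \<Sum>k\<in>cube m. g k)"
  using assms cube_finite_card(1) cube_disjoint by (intro sum.UNION_disjoint) blast+

text \<open>An isometry: the factor 2^(- m n z) offsets the number of points of
  \<open>cube m\<close>, so the step function has the same norm as its sequence of
  coefficients.\<close>

lemma lp_le_cubes:
  assumes "finite F" "0 \<le> z"  and b: "\<And>m. 0 \<le> b m"
  shows "lp_le z (\<Union>m\<in>F. cube m :: (int ^ 'n::finite) set) (\<lambda>k. (2 ^ cube_index k) powr (- real CARD('n) * z) * b (cube_index k)) D
    \<longleftrightarrow> lp_le z F b D"
proof (cases "z = 0")
  case True
  \<comment> \<open>In the supremum case the coefficient \<open>b m\<close> is recovered only if its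
    cube contains a point.\<close>
  have ne: "cube m \<noteq> ({} :: (int ^ 'n) set)" for m
    using cube_finite_card(2)[of m, where 'n = 'n] by (metis card.empty of_nat_0 powr_eq_0_iff power_not_zero zero_neq_numeral)
  show ?thesis
  proof
    assume *: "lp_le z (\<Union>m\<in>F. cube m :: (int ^ 'n::finite) set) (\<lambda>k. (2 ^ cube_index k) powr (- real CARD('n) * z) * b (cube_index k)) D"
    have "b m \<le> D" if "m \<in> F" for m
    proof -
      obtain k :: "int ^ 'n" where k: "k \<in> cube m" using ne by blast
      then have "(2 ^ cube_index k) powr (- real CARD('n) * z) * b (cube_index k) \<le> D"
        using * that True unfolding lp_le_def by auto
      then show ?thesis unfolding cube_index_eq[OF k] using True by simp
    qed
    then show "lp_le z F b D" using True unfolding lp_le_def by simp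
  next
    assume "lp_le z F b D"
    then show "lp_le z (\<Union>m\<in>F. cube m :: (int ^ 'n::finite) set) (\<lambda>k. (2 ^ cube_index k) powr (- real CARD('n) * z) * b (cube_index k)) D"
      using True unfolding lp_le_def by (auto dest!: cube_index_eq)
  qed
next
  case False
  have "(\<Sum>k\<in>(cube m :: (int ^ 'n) set). ((2 ^ cube_index k) powr (- real CARD('n) * z) * b (cube_index k)) powr (1 / z)) = b m powr (1 / z)" for m
  proof -
    have "(\<Sum>k\<in>(cube m :: (int ^ 'n) set). ((2 ^ cube_index k) powr (- real CARD('n) * z) * b (cube_index k)) powr (1 / z))
        = (\<Sum>k\<in>(cube m :: (int ^ 'n) set). ((2 ^ m) powr (- real CARD('n) * z) * b m) powr (1 / z))"
      by (intro sum.cong) (auto dest!: cube_index_eq)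
    also have "\<dots> = (2 ^ m) powr real CARD('n) * ((2 ^ m) powr (- real CARD('n) * z) * b m) powr (1 / z)"
      by (simp add: cube_finite_card(2))
    also have "((2 ^ m) powr (- real CARD('n) * z) * b m) powr (1 / z) = (2 ^ m) powr (- real CARD('n)) * b m powr (1 / z)"
      using False b[of m] by (simp add: powr_mult powr_powr)
    finally show ?thesis by (simp add: powr_minus_divide)
  qed
  then show ?thesis using False unfolding lp_le_def by (simp add: sum_cubes[OF assms(1)])
qed

text \<open>The matrix of the operator on functions constant on dyadic cubes, with a = n y + s and b = n x + t.\<close>

definition dyker :: "real \<Rightarrow> real \<Rightarrow> real \<Rightarrow> real \<Rightarrow> nat \<Rightarrow> nat \<Rightarrow> real" where
  "dyker n lam a b l m = (if l = m then 0 else 2 powr (real l * a + real m * (n - b) + max (real l) (real m) * (lam - n)))"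

text \<open>Between different cubes the distance is at most a multiple of max(2^l, 2^m). Since lam <
  n this bounds the kernel from below by a quantity depending only on l and m, and step functions
  turn it into the matrix.\<close>

lemma lp_bounded_dyker:
  assumes K: "lp_bounded x y (lker lam s t :: int ^ 'n::finite \<Rightarrow> int ^ 'n \<Rightarrow> real)"
    and n: "n = real CARD('n)" and lam: "lam < n" and xy: "0 \<le> x" "0 \<le> y"
  shows "lp_bounded x y (dyker n lam (n * y + s) (n * x + t))"
proof -
  obtain C where C0: "0 \<le> C" and C: "\<And>F G f. \<lbrakk>finite F; finite G; \<And>j. 0 \<le> f j; lp_le x F f 1\<rbrakk>
    \<Longrightarrow> lp_le y G (\<lambda>k. \<Sum>j\<in>F. (lker lam s t :: int ^ 'n \<Rightarrow> int ^ 'n \<Rightarrow> real) k j * f j) C"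
    using K by (rule lp_boundedE) blast
  define A where "A = 1 + 2 * n"
  have A1: "1 \<le> A" unfolding A_def n by simp
  \<comment> \<open>The factor A^(-|b|) covers both signs of the exponent: the bracket lies between
    2^m and A 2^m on \<open>cube m\<close>.\<close>
  have weight: "A powr (- \<bar>b\<bar>) * (2 ^ m) powr b \<le> jbr k powr b" if "k \<in> cube m" for b m and k :: "int ^ 'n"
  proof (cases "0 \<le> b")
    case True
    have "A powr (- \<bar>b\<bar>) * (2 ^ m) powr b \<le> 1 * (2 ^ m) powr b"
      using A1 by (intro mult_right_mono) (auto simp: powr_minus_divide ge_one_powr_ge_zero)
    also have "\<dots> \<le> jbr k powr b" using jbr_cube(1)[OF that] True by (simp add: powr_mono2)
    finally show ?thesis .
  next
    case False
    then have "A powr (- \<bar>b\<bar>) * (2 ^ m) powr b = (A * 2 ^ m) powr b" using A1 by (simp add: powr_mult)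
    also have "\<dots> \<le> jbr k powr b"
      using jbr_cube(2)[OF that] lattice.J_pos[of k] False unfolding A_def n by (intro powr_mono2') auto
    finally show ?thesis .
  qed
  define c where "c = A powr (- \<bar>s\<bar>) * (2 * A) powr (lam - n) * A powr (- \<bar>- t\<bar>)"
  have c: "0 < c" using A1 unfolding c_def by auto
  have low: "c * ((2 ^ l) powr s * (max (2 ^ l) (2 ^ m)) powr (lam - n) * (2 ^ m) powr (- t)) \<le> lker lam s t k j"
    if "k \<in> cube l" "j \<in> cube m" "l \<noteq> m" for l m and k j :: "int ^ 'n"
  proof -
    have "k \<noteq> j" using that cube_disjoint by blast
    then have "1 \<le> lat_norm (k - j)" by (intro lat_norm_ge_1) simp
    have "lat_norm (k - j) \<le> jbr k + jbr j"
      using lat_norm_le_jbr[of "k - j"] lattice.J_diff_le[of k j] by linarith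
    also have "\<dots> \<le> A * 2 ^ l + A * 2 ^ m"
      using jbr_cube(2)[OF that(1)] jbr_cube(2)[OF that(2)] unfolding A_def n by (intro add_mono) auto
    also have "\<dots> \<le> A * max (2 ^ l) (2 ^ m) + A * max (2 ^ l) (2 ^ m)"
      using A1 by (intro add_mono mult_left_mono) auto
    finally have "lat_norm (k - j) \<le> 2 * A * max (2 ^ l) (2 ^ m)" by simp
    then have "(2 * A * max (2 ^ l) (2 ^ m)) powr (lam - n) \<le> lat_norm (k - j) powr (lam - n)"
      using \<open>1 \<le> lat_norm (k - j)\<close> lam by (intro powr_mono2') auto
    also have "(2 * A * max (2 ^ l) (2 ^ m)) powr (lam - n) = (2 * A) powr (lam - n) * (max (2 ^ l) (2 ^ m)) powr (lam - n)"
      using A1 by (intro powr_mult)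
    finally have mid: "(2 * A) powr (lam - n) * (max (2 ^ l) (2 ^ m)) powr (lam - n) \<le> lat_norm (k - j) powr (lam - n)" .
    have "(A powr (- \<bar>s\<bar>) * (2 ^ l) powr s) * ((2 * A) powr (lam - n) * (max (2 ^ l) (2 ^ m)) powr (lam - n))
        * (A powr (- \<bar>- t\<bar>) * (2 ^ m) powr (- t)) \<le> lker lam s t k j"
      unfolding lker_def n[symmetric] by (intro mult_mono weight that mid) auto
    then show ?thesis unfolding c_def by (simp add: mult_ac)
  qed
  \<comment> \<open>Bookkeeping of powers of 2: (2^m)^n counts the points of the inner cube, and the
    factors with x and y come from the isometric normalisation of input and output.\<close>
  have dy: "c * ((2 ^ l) powr s * (max (2 ^ l) (2 ^ m)) powr (lam - n) * (2 ^ m) powr (- t)) * (2 ^ m) powr n * (2 ^ m) powr (- n * x)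
      = c * (2 ^ l) powr (- n * y) * dyker n lam (n * y + s) (n * x + t) l m" if "l \<noteq> m" for l m :: nat
  proof -
    have p: "(2 ^ m :: real) = 2 powr real m" for m by (simp add: powr_realpow)
    have mx: "max (2 powr real l) (2 powr real m) = 2 powr max (real l) (real m)" by (auto simp: max_def)
    have "(2 ^ l) powr s * (max (2 ^ l) (2 ^ m)) powr (lam - n) * (2 ^ m) powr (- t) * (2 ^ m) powr n * (2 ^ m) powr (- n * x)
      = 2 powr (real l * s + max (real l) (real m) * (lam - n) + real m * (- t) + real m * n + real m * (- n * x))"
      unfolding p mx powr_powr powr_add ..
    also have "\<dots> = 2 powr (real l * (- n * y) + (real l * (n * y + s) + real m * (n - (n * x + t)) + max (real l) (real m) * (lam - n)))"
      by (simp add: algebra_simps)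
    also have "\<dots> = (2 ^ l) powr (- n * y) * dyker n lam (n * y + s) (n * x + t) l m"
      using that unfolding p dyker_def powr_powr powr_add by simp
    finally show ?thesis by (simp only: mult.assoc)
  qed
  have dy0: "0 \<le> dyker n lam (n * y + s) (n * x + t) l m" for l m unfolding dyker_def by simp
  show ?thesis
  proof (rule lp_boundedI[of "(1 / c) * C"])
    fix F G :: "nat set" and a :: "nat \<Rightarrow> real"
    assume fin: "finite F" "finite G" and a0: "\<And>m. 0 \<le> a m" and a: "lp_le x F a 1"
    define f where "f = (\<lambda>k :: int ^ 'n. (2 ^ cube_index k) powr (- n * x) * a (cube_index k))"
    define v where "v = (\<lambda>l. \<Sum>m\<in>F. dyker n lam (n * y + s) (n * x + t) l m * a m)"
    have v0: "0 \<le> v l" for l unfolding v_def using dy0 a0 by (intro sum_nonneg) auto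
    let ?F = "\<Union>m\<in>F. cube m :: (int ^ 'n) set" and ?G = "\<Union>m\<in>G. cube m :: (int ^ 'n) set"
    have finC: "finite ?F" "finite ?G" using fin cube_finite_card(1) by auto
    have "lp_le x ?F f 1" using a unfolding f_def n by (subst lp_le_cubes[OF fin(1) xy(1) a0])
    then have le: "lp_le y ?G (\<lambda>k. \<Sum>j\<in>?F. lker lam s t k j * f j) C"
      by (intro C finC) (auto simp: f_def a0)
    have "lp_le y ?G (\<lambda>k. (2 ^ cube_index k) powr (- n * y) * (c * v (cube_index k))) C"
    proof (rule lp_le_mono[OF le xy(2)])
      fix k assume "k \<in> ?G"
      then obtain l where k: "k \<in> cube l" by blast
      have "(2 ^ cube_index k) powr (- n * y) * (c * v (cube_index k))
          = (\<Sum>m\<in>F. c * (2 ^ l) powr (- n * y) * dyker n lam (n * y + s) (n * x + t) l m * a m)"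
        unfolding v_def cube_index_eq[OF k] sum_distrib_left by (simp add: mult_ac)
      also have "\<dots> \<le> (\<Sum>m\<in>F. \<Sum>j\<in>cube m. lker lam s t k j * f j)"
      proof (rule sum_mono)
        fix m
        show "c * (2 ^ l) powr (- n * y) * dyker n lam (n * y + s) (n * x + t) l m * a m \<le> (\<Sum>j\<in>cube m. lker lam s t k j * f j)"
        proof (cases "l = m")
          case True
          then have "c * (2 ^ l) powr (- n * y) * dyker n lam (n * y + s) (n * x + t) l m * a m = 0"
            unfolding dyker_def by simp
          also have "0 \<le> (\<Sum>j\<in>cube m. lker lam s t k j * f j)"
            using a0 lker_nonneg by (auto simp: f_def intro!: sum_nonneg mult_nonneg_nonneg)
          finally show ?thesis .
        next
          case False
          let ?Q = "c * ((2 ^ l) powr s * (max (2 ^ l) (2 ^ m)) powr (lam - n) * (2 ^ m) powr (- t))"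
          have "c * (2 ^ l) powr (- n * y) * dyker n lam (n * y + s) (n * x + t) l m * a m
              = ?Q * (2 ^ m) powr n * (2 ^ m) powr (- n * x) * a m"
            unfolding dy[OF False, symmetric] ..
          also have "\<dots> = (2 ^ m) powr n * (?Q * ((2 ^ m) powr (- n * x) * a m))"
            by (simp only: mult_ac)
          also have "\<dots> = (\<Sum>j\<in>(cube m :: (int ^ 'n) set). ?Q * ((2 ^ m) powr (- n * x) * a m))"
            unfolding sum_constant cube_finite_card(2) n ..
          also have "\<dots> \<le> (\<Sum>j\<in>cube m. lker lam s t k j * f j)"
          proof (rule sum_mono)
            fix j :: "int ^ 'n" assume j: "j \<in> cube m"
            show "?Q * ((2 ^ m) powr (- n * x) * a m) \<le> lker lam s t k j * f j"
              unfolding f_def cube_index_eq[OF j] using a0 by (intro mult_right_mono low k j False) auto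
          qed
          finally show ?thesis .
        qed
      qed
      also have "\<dots> = (\<Sum>j\<in>?F. lker lam s t k j * f j)" by (rule sum_cubes[OF fin(1), symmetric])
      finally show "(2 ^ cube_index k) powr (- n * y) * (c * v (cube_index k)) \<le> (\<Sum>j\<in>?F. lker lam s t k j * f j)" .
    qed (use v0 c in auto)
    then have "lp_le y G (\<lambda>l. c * v l) C"
      unfolding n by (subst (asm) lp_le_cubes[OF fin(2) xy(2)]) (use v0 c in auto)
    then have "lp_le y G (\<lambda>l. (1 / c) * (c * v l)) ((1 / c) * C)"
      by (rule lp_le_scale) (use v0 c C0 in auto)
    then show "lp_le y G (\<lambda>l. \<Sum>m\<in>F. dyker n lam (n * y + s) (n * x + t) l m * a m) ((1 / c) * C)"
      using c unfolding v_def by simp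
  qed (use c C0 in auto)
qed

section \<open>Test sequences for matrices\<close>

text \<open>On \<open>M\<close> entries equal to 1 in one row, the normalised constant M^(-x)
  produces the output M^(1 - x), which is bounded in \<open>M\<close> only for x = 1.\<close>

lemma lp_bounded_row:
  assumes "lp_bounded x y K" "0 \<le> x" "x \<le> 1" "0 \<le> y" and K0: "\<And>k j. 0 \<le> K k j"
    and row: "\<And>M::nat. 0 < M \<Longrightarrow> \<exists>k F. finite F \<and> card F = M \<and> (\<forall>j\<in>F. K k j = 1)"
  shows "x = 1"
proof -
  obtain C where C0: "0 \<le> C" and C: "\<And>F G f. \<lbrakk>finite F; finite G; \<And>j. 0 \<le> f j; lp_le x F f 1\<rbrakk>
    \<Longrightarrow> lp_le y G (\<lambda>k. \<Sum>j\<in>F. K k j * f j) C"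
    using assms(1) by (rule lp_boundedE) blast
  have "real M powr (1 - x) \<le> C" if M: "0 < M" for M :: nat
  proof -
    obtain k F where F: "finite F" "card F = M" "\<forall>j\<in>F. K k j = 1" using row[OF M] by blast
    have "lp_le y {k} (\<lambda>k. \<Sum>j\<in>F. K k j * real M powr (- x)) C"
      by (rule C) (use F(1) lp_le_const[OF assms(2) F(1,2) M] in auto)
    then have "(\<Sum>j\<in>F. K k j * real M powr (- x)) \<le> C"
      by (rule lp_le_point) (use assms C0 in \<open>auto intro!: sum_nonneg\<close>)
    also have "(\<Sum>j\<in>F. K k j * real M powr (- x)) = (\<Sum>j\<in>F. real M powr (- x))"
      using F(3) by (intro sum.cong) auto
    also have "\<dots> = real M powr (1 - x)" using F(2) M by (simp add: powr_diff powr_minus_divide)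
    finally show ?thesis .
  qed
  then have "1 - x \<le> 0" by (intro powr_bounded_imp_nonpos[of 0 "1 - x" C])
  then show ?thesis using assms by simp
qed

lemma lp_bounded_column:
  assumes "lp_bounded x y K" "0 \<le> x" "x \<le> 1" "0 \<le> y" "y \<le> 1" and K0: "\<And>k j. 0 \<le> K k j"
    and col: "\<And>M::nat. 0 < M \<Longrightarrow> \<exists>j G. finite G \<and> card G = M \<and> (\<forall>k\<in>G. K k j = 1)"
  shows "y = 0"
proof -
  have "lp_bounded (1 - y) (1 - x) (\<lambda>j k. K k j)" by (rule lp_bounded_dual) (use assms in auto)
  then have "1 - y = 1" by (rule lp_bounded_row) (use assms in auto)
  then show ?thesis by simp
qed

text \<open>Such a matrix contains a shift bounded below. The normalised constant on
  \<open>M\<close> points has an output of norm at least c M^(y - x), which forces y <= x.\<close>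

lemma lp_bounded_subdiagonal:
  fixes K :: "nat \<Rightarrow> nat \<Rightarrow> real"
  assumes "lp_bounded x y K" "0 \<le> x" "0 \<le> y" and K0: "\<And>k j. 0 \<le> K k j"
    and c: "0 < c" "\<And>m. c \<le> K (Suc m) m"
  shows "y \<le> x"
proof (cases "y = 0")
  case False
  then have y: "0 < y" using assms by simp
  obtain C where C0: "0 \<le> C" and C: "\<And>F G f. \<lbrakk>finite F; finite G; \<And>j. 0 \<le> f j; lp_le x F f 1\<rbrakk>
    \<Longrightarrow> lp_le y G (\<lambda>k. \<Sum>j\<in>F. K k j * f j) C"
    using assms(1) by (rule lp_boundedE) blast
  have "real M powr (1 - x / y) \<le> (C / c) powr (1 / y)" if M: "0 < M" for M :: nat
  proof -
    have "lp_le y (Suc ` {..<M}) (\<lambda>k. \<Sum>j<M. K k j * real M powr (- x)) C"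
      by (rule C) (use lp_le_const[OF assms(2), of "{..<M}" M] M in auto)
    then have "lp_le y (Suc ` {..<M}) (\<lambda>k. c * real M powr (- x)) C"
    proof (rule lp_le_mono)
      fix k assume "k \<in> Suc ` {..<M}"
      then obtain m where m: "m < M" "k = Suc m" by auto
      have "c * real M powr (- x) \<le> K k m * real M powr (- x)"
        using c m by (intro mult_right_mono) auto
      also have "\<dots> \<le> (\<Sum>j<M. K k j * real M powr (- x))"
        by (rule member_le_sum) (use m K0 in auto)
      finally show "c * real M powr (- x) \<le> (\<Sum>j<M. K k j * real M powr (- x))" .
    qed (use assms in auto)
    then have "real M * (c * real M powr (- x)) powr (1 / y) \<le> C powr (1 / y)"
      using False unfolding lp_le_def by (simp add: card_image)
    moreover have "real M * (c * real M powr (- x)) powr (1 / y) = c powr (1 / y) * real M powr (1 - x / y)"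
    proof -
      have "real M powr (1 - x / y) = real M * real M powr (- (x / y))"
        using M by (simp add: powr_diff powr_minus_divide)
      then show ?thesis by (simp add: powr_mult powr_powr)
    qed
    ultimately show ?thesis using c C0 by (simp add: powr_divide field_simps)
  qed
  then have "1 - x / y \<le> 0" by (intro powr_bounded_imp_nonpos[of 0])
  then show ?thesis using y by (simp add: field_simps)
qed (use assms in simp)

text \<open>The inequalities come from single entries that would otherwise grow geometrically. In
  each equality case for an end point, some rows or columns consist of ones along arbitrarily long
  stretches.\<close>

lemma dyker_necessary:
  assumes K: "lp_bounded x y (dyker n lam a b)" and xy: "0 \<le> x" "x \<le> 1" "0 \<le> y" "y \<le> 1" and lam: "0 < lam" "lam < n"
  shows "a + lam \<le> b" "lam \<le> b" "a + lam \<le> n" "a + lam = b \<Longrightarrow> y \<le> x"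
    "b = lam \<Longrightarrow> x = 1" "b = lam \<Longrightarrow> a = 0 \<Longrightarrow> y = 0"
    "a + lam = n \<Longrightarrow> y = 0" "a + lam = n \<Longrightarrow> b = n \<Longrightarrow> x = 1"
proof -
  have K0: "0 \<le> dyker n lam a b l m" for l m unfolding dyker_def by simp
  obtain C where C: "0 \<le> C" "\<And>l m. dyker n lam a b l m \<le> C"
    using lp_bounded_entry[OF K xy(3) K0] by blast
  \<comment> \<open>Entries just below the diagonal; the next two families run along row 0 and
    column 0.\<close>
  have "2 powr (real m * (a + lam - b) + (a + lam - n)) \<le> C" for m
    using C(2)[of "Suc m" m] unfolding dyker_def by (simp add: algebra_simps)
  then have "a + lam - b \<le> 0" by (rule two_powr_bounded_imp_nonpos)
  then show "a + lam \<le> b" by simp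
  have "2 powr (real m * (lam - b) + (lam - b)) \<le> C" for m
    using C(2)[of 0 "Suc m"] unfolding dyker_def by (simp add: algebra_simps)
  then have "lam - b \<le> 0" by (rule two_powr_bounded_imp_nonpos)
  then show "lam \<le> b" by simp
  have "2 powr (real m * (a + lam - n) + (a + lam - n)) \<le> C" for m
    using C(2)[of "Suc m" 0] unfolding dyker_def by (simp add: algebra_simps)
  then have "a + lam - n \<le> 0" by (rule two_powr_bounded_imp_nonpos)
  then show "a + lam \<le> n" by simp
  show "y \<le> x" if "a + lam = b"
  proof (rule lp_bounded_subdiagonal[OF K xy(1,3) K0])
    show "2 powr (a + lam - n) \<le> dyker n lam a b (Suc m) m" for m
      unfolding dyker_def that[symmetric] by (simp add: algebra_simps)
  qed simp
  have sh: "finite {1..M}" "card {1..M} = M" for M :: nat by auto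
  show "x = 1" if "b = lam"
  \<comment> \<open>For b = lam the whole of row 0 off the diagonal equals 1; if also a = 0, so does
    the part of each column above the diagonal.\<close>
  proof (rule lp_bounded_row[OF K xy(1,2,3) K0])
    show "\<exists>k F. finite F \<and> card F = M \<and> (\<forall>j\<in>F. dyker n lam a b k j = 1)" for M
      using that by (intro exI[of _ 0] exI[of _ "{1..M}"]) (auto simp: dyker_def algebra_simps)
  qed
  show "y = 0" if "b = lam" "a = 0"
  proof (rule lp_bounded_column[OF K xy K0])
    show "\<exists>j G. finite G \<and> card G = M \<and> (\<forall>k\<in>G. dyker n lam a b k j = 1)" for M
      using that by (intro exI[of _ M] exI[of _ "{..<M}"]) (auto simp: dyker_def algebra_simps)
  qed
  show "y = 0" if "a + lam = n"
  \<comment> \<open>For a = n - lam column 0 equals 1 off the diagonal; if also b = n, each row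
    equals 1 to the left of the diagonal.\<close>
  proof (rule lp_bounded_column[OF K xy K0])
    have a: "a = n - lam" using that by simp
    show "\<exists>j G. finite G \<and> card G = M \<and> (\<forall>k\<in>G. dyker n lam a b k j = 1)" for M
      by (intro exI[of _ 0] exI[of _ "{1..M}"]) (auto simp: a dyker_def algebra_simps)
  qed
  show "x = 1" if "a + lam = n" "b = n"
  proof (rule lp_bounded_row[OF K xy(1,2,3) K0])
    have a: "a = n - lam" using that by simp
    show "\<exists>k F. finite F \<and> card F = M \<and> (\<forall>j\<in>F. dyker n lam a b k j = 1)" for M
      using that(2) by (intro exI[of _ M] exI[of _ "{..<M}"]) (auto simp: a dyker_def algebra_simps)
  qed
qed

section \<open>Neighbouring points and translation to infinity\<close>

lemma le_jbr_const: "real m \<le> jbr (vec (int m) :: int ^ 'n::finite)"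
  using abs_component_le_lat_norm[of "vec (int m) :: int ^ 'n" undefined]
    lat_norm_le_jbr[of "vec (int m) :: int ^ 'n"] by simp

text \<open>Two points at the fixed distance |(1,...,1)|, moved to infinity along the main diagonal,
  have a kernel entry of order m^(s - t), which must stay bounded.\<close>

lemma lp_bounded_lker_imp_le:
  assumes K: "lp_bounded x y (lker lam s t :: int ^ 'n::finite \<Rightarrow> int ^ 'n \<Rightarrow> real)" and y: "0 \<le> y"
  shows "s \<le> t"
proof (rule ccontr)
  assume "\<not> s \<le> t"
  then have st: "0 < s - t" by simp
  let ?e = "1 :: int ^ 'n"
  obtain C where C: "0 \<le> C" "\<And>k j. (lker lam s t :: int ^ 'n \<Rightarrow> int ^ 'n \<Rightarrow> real) k j \<le> C"
    using lp_bounded_entry[OF K y lker_nonneg] by blast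
  \<comment> \<open>Beyond \<open>N\<close> the shift by \<open>?e\<close> changes the bracket by at
    most a factor 2.\<close>
  obtain N :: nat where N: "2 * jbr ?e \<le> real N" using real_arch_simple by blast
  define c where "c = lat_norm ?e powr (lam - real CARD('n)) / 2 powr \<bar>s\<bar>"
  have "1 \<le> lat_norm ?e" by (rule lat_norm_ge_1) (simp add: vec_eq_iff)
  then have c: "0 < c" unfolding c_def by simp
  have "real m powr (s - t) \<le> C / c" if m: "N \<le> m" "0 < m" for m
  proof -
    define j where "j = (vec (int m) :: int ^ 'n)"
    have J: "real m \<le> jbr j" unfolding j_def by (rule le_jbr_const)
    have e: "2 * jbr ?e \<le> jbr j" using J N m by linarith
    have "jbr j \<le> jbr (j + ?e) + jbr ?e" using lattice.J_diff_le[of "j + ?e" ?e] by simp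
    then have "jbr j \<le> 2 * jbr (j + ?e)" using e by linarith
    moreover have "jbr (j + ?e) \<le> 2 * jbr j" using jbr_add[of j ?e] e lattice.J_pos[of ?e] by linarith
    ultimately have "jbr j powr s \<le> 2 powr \<bar>s\<bar> * jbr (j + ?e) powr s" by (intro lattice.comparable_powr)
    then have le: "jbr j powr s / 2 powr \<bar>s\<bar> \<le> jbr (j + ?e) powr s" by (simp add: field_simps)
    have "real m powr (s - t) \<le> jbr j powr (s - t)" using J st by (intro powr_mono2) auto
    then have "c * real m powr (s - t) \<le> c * jbr j powr (s - t)" using c by simp
    also have "jbr j powr (s - t) = jbr j powr s * jbr j powr (- t)" by (simp flip: powr_add)
    also have "c * (jbr j powr s * jbr j powr (- t)) = jbr j powr s / 2 powr \<bar>s\<bar> * lat_norm ?e powr (lam - real CARD('n)) * jbr j powr (- t)"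
      unfolding c_def by simp
    also have "\<dots> \<le> jbr (j + ?e) powr s * lat_norm ?e powr (lam - real CARD('n)) * jbr j powr (- t)"
      by (intro mult_right_mono le) auto
    also have "\<dots> = lker lam s t (j + ?e) j" unfolding lker_def by simp
    also have "\<dots> \<le> C" by (rule C)
    finally show ?thesis using c by (simp add: field_simps)
  qed
  then have "s - t \<le> 0" by (rule powr_bounded_imp_nonpos)
  with st show False by simp
qed

text \<open>Test functions are translated so far from the origin that the two weights cancel up to a constant.\<close>

lemma lp_bounded_lker_unweighted:
  assumes K: "lp_bounded x y (lker lam s s :: int ^ 'n::finite \<Rightarrow> int ^ 'n \<Rightarrow> real)" and y: "0 \<le> y"
  shows "lp_bounded x y (lker lam 0 0 :: int ^ 'n \<Rightarrow> int ^ 'n \<Rightarrow> real)"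
proof -
  obtain C where C0: "0 \<le> C" and C: "\<And>F G f. \<lbrakk>finite F; finite G; \<And>j. 0 \<le> f j; lp_le x F f 1\<rbrakk>
    \<Longrightarrow> lp_le y G (\<lambda>k. \<Sum>j\<in>F. (lker lam s s :: int ^ 'n \<Rightarrow> int ^ 'n \<Rightarrow> real) k j * f j) C"
    using K by (rule lp_boundedE) blast
  show ?thesis
  proof (rule lp_boundedI[of "2 powr \<bar>s\<bar> * C"])
    fix F G :: "(int ^ 'n) set" and f :: "int ^ 'n \<Rightarrow> real"
    assume fin: "finite F" "finite G" and f0: "\<And>j. 0 \<le> f j" and f: "lp_le x F f 1"
    define S where "S = (\<Sum>i\<in>F \<union> G. jbr i)"
    have S: "jbr i \<le> S" if "i \<in> F \<union> G" for i
      unfolding S_def using that fin lattice.J_pos by (intro member_le_sum) (auto intro: less_imp_le)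
    \<comment> \<open>With |v| this large all translated brackets are at least 2S and differ by at
      most 2S, hence agree up to a factor 2.\<close>
    obtain N :: nat where N: "3 * S \<le> real N" using real_arch_simple by blast
    define v where "v = (vec (int N) :: int ^ 'n)"
    have v: "3 * S \<le> jbr v" unfolding v_def using N le_jbr_const[of N, where 'n = 'n] by linarith
    have cmp: "jbr (i + v) \<le> 2 * jbr (j + v)" if "i \<in> F \<union> G" "j \<in> F \<union> G" for i j
    proof -
      have "jbr v \<le> jbr (j + v) + jbr j" using lattice.J_diff_le[of "j + v" j] by simp
      moreover have "jbr (i + v) \<le> jbr (j + v) + jbr (i - j)" using lattice.J_le_add_diff[of "i + v" "j + v"] by simp
      moreover have "jbr (i - j) \<le> jbr i + jbr j" by (rule lattice.J_diff_le)
      ultimately show ?thesis using S[OF that(1)] S[OF that(2)] v by linarith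
    qed
    have lk: "lker lam 0 0 k j \<le> 2 powr \<bar>s\<bar> * lker lam s s (k + v) (j + v)" if "k \<in> G" "j \<in> F" for k j
    proof -
      have pos: "0 < jbr (k + v)" "0 < jbr (j + v)" by (rule lattice.J_pos)+
      have "jbr (j + v) powr s \<le> 2 powr \<bar>s\<bar> * jbr (k + v) powr s"
        by (rule lattice.comparable_powr) (use cmp that in auto)
      then have "1 \<le> 2 powr \<bar>s\<bar> * (jbr (k + v) powr s * jbr (j + v) powr (- s))"
        using pos by (simp add: powr_minus_divide field_simps)
      then have "lat_norm (k - j) powr (lam - real CARD('n)) * 1
        \<le> lat_norm (k - j) powr (lam - real CARD('n)) * (2 powr \<bar>s\<bar> * (jbr (k + v) powr s * jbr (j + v) powr (- s)))"
        by (intro mult_left_mono) auto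
      then show ?thesis unfolding lker_def using lattice.J_pos[of k] lattice.J_pos[of j] by (simp add: mult_ac)
    qed
    have inj: "inj_on (\<lambda>i. i + v) X" for X by (auto simp: inj_on_def)
    have "lp_le y ((\<lambda>i. i + v) ` G) (\<lambda>k. \<Sum>j\<in>(\<lambda>i. i + v) ` F. lker lam s s k j * f (j - v)) C"
      by (rule C) (use fin f0 f in \<open>auto simp: lp_le_reindex[OF inj]\<close>)
    then have "lp_le y G (\<lambda>k. \<Sum>j\<in>F. lker lam s s (k + v) (j + v) * f j) C"
      by (simp add: lp_le_reindex[OF inj] sum.reindex[OF inj])
    then have "lp_le y G (\<lambda>k. 2 powr \<bar>s\<bar> * (\<Sum>j\<in>F. lker lam s s (k + v) (j + v) * f j)) (2 powr \<bar>s\<bar> * C)"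
      by (rule lp_le_scale) (use C0 f0 lker_nonneg in \<open>auto intro!: sum_nonneg mult_nonneg_nonneg\<close>)
    then show "lp_le y G (\<lambda>k. \<Sum>j\<in>F. lker lam 0 0 k j * f j) (2 powr \<bar>s\<bar> * C)"
    proof (rule lp_le_mono)
      fix k assume k: "k \<in> G"
      show "(\<Sum>j\<in>F. lker lam 0 0 k j * f j) \<le> 2 powr \<bar>s\<bar> * (\<Sum>j\<in>F. lker lam s s (k + v) (j + v) * f j)"
        unfolding sum_distrib_left mult.assoc[symmetric] by (intro sum_mono mult_right_mono lk k f0)
    qed (use y f0 lker_nonneg in \<open>auto intro!: sum_nonneg mult_nonneg_nonneg\<close>)
  qed (use C0 in auto)
qed

text \<open>The matrix conditions for a = n y + s and b = n x + t are sorted by whether b = lam and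
  whether a + lam = b; s <= t and the unweighted kernel remove the remaining end points.\<close>

lemma lker_necessary:
  assumes K: "lp_bounded x y (lker lam s t :: int ^ 'n::finite \<Rightarrow> int ^ 'n \<Rightarrow> real)"
    and n: "n = real CARD('n)" and lam: "0 < lam" "lam < n" and xy: "0 \<le> x" "x \<le> 1" "0 \<le> y" "y \<le> 1"
  shows "s \<le> t \<and> (lam + max (n * y + s) 0 < max (n * x + t) 0 \<and> lam + n * y + s \<le> n \<and> (lam + n * y + s = n \<longrightarrow> y = 0)
      \<or> x = 1 \<and> t = lam - n \<and> n * y + s < 0
      \<or> lam + n * y + s = n * x + t \<and> y \<le> x \<and> 0 < n * y + s \<and> n * x + t < n \<and> (s = t \<longrightarrow> 0 < y \<and> x < 1))"
proof -
  have st: "s \<le> t" by (rule lp_bounded_lker_imp_le[OF K xy(3)])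
  define a where "a = n * y + s"
  define b where "b = n * x + t"
  note N = dyker_necessary[OF lp_bounded_dyker[OF K n lam(2) xy(1,3)] xy lam, folded a_def b_def]
  have ends: "0 < y \<and> x < 1" if "s = t" "a + lam = b"
  proof -
    have "lp_bounded x y (dyker n lam (n * y + 0) (n * x + 0))"
      using lp_bounded_lker_unweighted[of x y lam t] K that xy n lam by (intro lp_bounded_dyker) auto
    note N0 = dyker_necessary[OF this xy lam]
    have eq: "n * y + lam = n * x" using that unfolding a_def b_def by simp
    have "y \<noteq> 0"
    proof
      assume "y = 0"
      then have "n * x = lam" using eq by simp
      then have "x = 1" using N0(5) by simp
      then show False using \<open>n * x = lam\<close> lam by simp
    qed
    moreover have "x \<noteq> 1"
    proof
      assume "x = 1"
      then have "n * y + lam = n" using eq by simp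
      then have "y = 0" using N0(7) by simp
      then show False using \<open>n * y + lam = n\<close> lam by simp
    qed
    ultimately show ?thesis using xy by simp
  qed
  have "lam + max a 0 < max b 0 \<and> a + lam \<le> n \<and> (a + lam = n \<longrightarrow> y = 0)
      \<or> x = 1 \<and> t = lam - n \<and> a < 0
      \<or> a + lam = b \<and> y \<le> x \<and> 0 < a \<and> b < n \<and> (s = t \<longrightarrow> 0 < y \<and> x < 1)"
  proof (cases "b = lam")
    case True
    then have x: "x = 1" by (rule N(5))
    then have t: "t = lam - n" using True unfolding b_def by simp
    \<comment> \<open>Otherwise y = 0 and s = 0, which contradicts s <= t = lam - n < 0.\<close>
    have "a \<noteq> 0"
    proof
      assume "a = 0"
      then have "y = 0" using N(6) True by simp
      then have "s = 0" using \<open>a = 0\<close> unfolding a_def by simp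
      then show False using st t lam by simp
    qed
    then show ?thesis using N(1) True x t by auto
  next
    case False
    then have b: "lam < b" using N(2) by simp
    show ?thesis
    proof (cases "a + lam = b")
      case False
      then show ?thesis using N(1,3,7) b lam by (auto simp: max_def)
    next
      case True
      \<comment> \<open>Otherwise both end points hold, giving s = n - lam > 0 = t.\<close>
      have "b \<noteq> n"
      proof
        assume "b = n"
        then have "y = 0" "x = 1" using N(7,8) True by auto
        then have "s = n - lam" "t = 0" using True \<open>b = n\<close> unfolding a_def b_def by auto
        then show False using st lam by simp
      qed
      then show ?thesis using True b N(3,4) ends by auto
    qed
  qed
  then show ?thesis using st unfolding a_def b_def by (simp add: add_ac)
qed

theorem theorem1p6:
  fixes lam s t :: real and p q :: ereal
  defines "n \<equiv> real CARD('n::finite)"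
  assumes "0 < lam" "lam < n" "1 \<le> p" "1 \<le> q"
  shows "frac_int_bounded lam TYPE('n) p t q s \<longleftrightarrow>
    ( (s \<le> t
       \<and> lam / n + max (recip q + s / n) 0 < max (recip p + t / n) 0
       \<and> lam / n + recip q + s / n \<le> 1
       \<and> (lam / n + recip q + s / n = 1 \<longrightarrow> dual_exp q = 1 \<and> - s = lam - n))
    \<or> (s \<le> t \<and> p = 1 \<and> t = lam - n \<and> recip q + s / n < 0)
    \<or> (s \<le> t
       \<and> lam / n + recip q + s / n = recip p + t / n \<and> recip q \<le> recip p
       \<and> recip q + s / n > 0 \<and> recip p + t / n < 1
       \<and> (s = t \<longrightarrow> q \<noteq> \<infinity> \<and> p \<noteq> 1)))"
proof -
  let ?x = "recip p" and ?y = "recip q"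
  have n: "0 < n" using assms by simp
  have p: "0 \<le> ?x" "?x \<le> 1" and q: "0 \<le> ?y" "?y \<le> 1" using recip_bounds assms by auto
  define K where "K = (lker lam s t :: int ^ 'n \<Rightarrow> int ^ 'n \<Rightarrow> real)"
  \<comment> \<open>The three alternatives multiplied by n, with exponent conditions expressed
    through the reciprocals.\<close>
  let ?R = "s \<le> t \<and> (lam + max (n * ?y + s) 0 < max (n * ?x + t) 0 \<and> lam + n * ?y + s \<le> n \<and> (lam + n * ?y + s = n \<longrightarrow> ?y = 0)
      \<or> ?x = 1 \<and> t = lam - n \<and> n * ?y + s < 0
      \<or> lam + n * ?y + s = n * ?x + t \<and> ?y \<le> ?x \<and> 0 < n * ?y + s \<and> n * ?x + t < n \<and> (s = t \<longrightarrow> 0 < ?y \<and> ?x < 1))"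
  have "lp_bounded ?x ?y K \<longleftrightarrow> ?R"
  proof
    assume "lp_bounded ?x ?y K"
    then show ?R unfolding K_def by (rule lker_necessary) (use assms p q in \<open>auto simp: n_def\<close>)
  next
    assume R: ?R
    have "lp_bounded ?x ?y (lattice.wker lam s t :: int ^ 'n \<Rightarrow> int ^ 'n \<Rightarrow> real)"
      by (rule lattice.lp_bounded_wker) (use R assms p q in \<open>auto simp: n_def\<close>)
    then show "lp_bounded ?x ?y K"
      unfolding K_def by (rule lp_bounded_lker) (use assms q in \<open>auto simp: n_def\<close>)
  qed
  then have "frac_int_bounded lam TYPE('n) p t q s \<longleftrightarrow> ?R"
    unfolding K_def using frac_int_bounded_if_lp_bounded lp_bounded_if_frac_int_bounded assms(4,5) by blast
  moreover have "n * (lam / n + max (?y + s / n) 0) = lam + max (n * ?y + s) 0"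
    using n by (auto simp: max_def field_simps)
  moreover have "n * max (?x + t / n) 0 = max (n * ?x + t) 0"
    using n by (auto simp: max_def field_simps)
  ultimately have 1: "lam / n + max (?y + s / n) 0 < max (?x + t / n) 0 \<longleftrightarrow> lam + max (n * ?y + s) 0 < max (n * ?x + t) 0"
    using n by (metis mult_less_cancel_left_pos)
  have 2: "lam / n + ?y + s / n \<le> 1 \<longleftrightarrow> lam + n * ?y + s \<le> n" "lam / n + ?y + s / n = 1 \<longleftrightarrow> lam + n * ?y + s = n"
    "?y + s / n < 0 \<longleftrightarrow> n * ?y + s < 0" "0 < ?y + s / n \<longleftrightarrow> 0 < n * ?y + s" "?x + t / n < 1 \<longleftrightarrow> n * ?x + t < n"
    "lam / n + ?y + s / n = ?x + t / n \<longleftrightarrow> lam + n * ?y + s = n * ?x + t"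
    using n by (auto simp: field_simps)
  have 3: "?x = 1 \<longleftrightarrow> p = 1" "?y = 0 \<longleftrightarrow> q = \<infinity>" "dual_exp q = 1 \<longleftrightarrow> q = \<infinity>"
    using recip_eq_1_iff recip_eq_0_iff dual_exp_eq_1_iff assms by auto
  have 4: "0 < ?y \<longleftrightarrow> q \<noteq> \<infinity>" "?x < 1 \<longleftrightarrow> p \<noteq> 1" using 3 p q by auto
  \<comment> \<open>On the line lam + n y + s = n the value y = 0 already gives s = n - lam, so the
    second half of the end-point condition follows from the first.\<close>
  have 5: "lam + n * ?y + s = n \<longrightarrow> (?y = 0 \<longleftrightarrow> dual_exp q = 1 \<and> - s = lam - n)" using 3 by auto
  show ?thesis
    unfolding \<open>frac_int_bounded lam TYPE('n) p t q s \<longleftrightarrow> ?R\<close> 1 2 using 3 4 5 by blast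
qed

end
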